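(* Let $\gamma$ be a hedgehog with smooth $2\pi$-periodic support function $p$, let $\gamma_0=\gamma$ and let $\gamma_{k+1}$ be the evolute of $\gamma_k$ for $k\ge 0$. If $p$ is a trigonometric polynomial of degree $n\ge 1$, then the limiting shape of the iterated evolutes $\gamma_k$ is a hypocycloid of order $n$: denoting by $p_k$ the support function of $\gamma_k$, there exist constants $c_k\neq 0$ and $s_k\in\mathbb R$ such that $c_k\,p_k(\alpha+s_k)$ converges uniformly, as $k\to\infty$, to a nonzero function of the form $a\cos n\alpha+b\sin n\alpha$. If $p$ is not a trigonometric polynomial, then the number of cusps of $\gamma_k$ increases without bound, i.e. tends to infinity as $k\to\infty$.
   Context: A hedgehog is a cooriented closed plane wave front without inflections and with total turning $2\pi$. It is described by its support function $p(\alpha)$, a $2\pi$-periodic function giving the signed distance from the origin to the tangent line with coorienting normal $(\cos\alpha,\sin\alpha)$; the corresponding point of the curve is $(p\cos\alpha-p'\sin\alpha,\ p\sin\alpha+p'\cos\alpha)$. The evolute is the envelope of the normal lines, the normal at the point with parameter $\alpha$ being cooriented by $(-\sin\alpha,\cos\alpha)$; thus the support function of the evolute is $\alpha\mapsto p'(\alpha-\pi/2)$. The cusps of a hedgehog with support function $p$ are the points where its radius of curvature $p+p''$ vanishes; their number is the number (possibly infinite) of zeros of $p+p''$ in $[0,2\pi)$. A hypocycloid of order $n$ is a hedgehog whose support function is a pure harmonic $a\cos n\alpha+b\sin n\alpha$ of order $n$. Shapes of curves are considered up to dilation (multiplying the support function by a nonzero factor) and rotation (shifting the argument). *)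

theory Defs
  imports "HOL-Analysis.Analysis"
begin

(* All geometric notions are functions of the support function p of the hedgehog. *)

definition smooth :: "(real \<Rightarrow> real) \<Rightarrow> bool" where
  "smooth f \<longleftrightarrow> (\<forall>k x. (deriv ^^ k) f differentiable at x)"

definition hedgehog :: "(real \<Rightarrow> real) \<Rightarrow> bool" where
  "hedgehog p \<longleftrightarrow> smooth p \<and> (\<forall>\<alpha>. p (\<alpha> + 2 * pi) = p \<alpha>)"

definition dir :: "real \<Rightarrow> real \<times> real" where
  "dir \<alpha> = (cos \<alpha>, sin \<alpha>)"

definition curve_point :: "(real \<Rightarrow> real) \<Rightarrow> real \<Rightarrow> real \<times> real" where
  "curve_point p \<alpha> =
     (p \<alpha> * cos \<alpha> - deriv p \<alpha> * sin \<alpha>, p \<alpha> * sin \<alpha> + deriv p \<alpha> * cos \<alpha>)"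

(* The tangent line of the evolute with coorienting normal dir \<beta> is the normal line of the curve
   cooriented by dir \<beta>. As (- sin \<alpha>, cos \<alpha>) = dir (\<alpha> + pi/2), this is the normal at the point
   with parameter \<beta> - pi/2, and its signed distance from the origin is the inner product below. *)
definition evolute :: "(real \<Rightarrow> real) \<Rightarrow> real \<Rightarrow> real" where
  "evolute p \<beta> = curve_point p (\<beta> - pi / 2) \<bullet> dir \<beta>"

definition iterated_evolute :: "nat \<Rightarrow> (real \<Rightarrow> real) \<Rightarrow> real \<Rightarrow> real" where
  "iterated_evolute k p = (evolute ^^ k) p"

definition curvature_radius :: "(real \<Rightarrow> real) \<Rightarrow> real \<Rightarrow> real" where
  "curvature_radius p \<alpha> = p \<alpha> + deriv (deriv p) \<alpha>"

definition cusps :: "(real \<Rightarrow> real) \<Rightarrow> real set" where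
  "cusps p = {\<alpha> \<in> {0..<2 * pi}. curvature_radius p \<alpha> = 0}"

definition num_cusps :: "(real \<Rightarrow> real) \<Rightarrow> enat" where
  "num_cusps p = (if finite (cusps p) then enat (card (cusps p)) else \<infinity>)"

definition trig_sum :: "(nat \<Rightarrow> real) \<Rightarrow> (nat \<Rightarrow> real) \<Rightarrow> nat \<Rightarrow> real \<Rightarrow> real" where
  "trig_sum a b n \<alpha> = (\<Sum>k\<le>n. a k * cos (real k * \<alpha>) + b k * sin (real k * \<alpha>))"

definition trig_polynomial :: "(real \<Rightarrow> real) \<Rightarrow> bool" where
  "trig_polynomial f \<longleftrightarrow> (\<exists>n a b. f = trig_sum a b n)"

(* The coefficient b 0 is immaterial, so it does not count as a leading coefficient. *)
definition trig_polynomial_of_degree :: "nat \<Rightarrow> (real \<Rightarrow> real) \<Rightarrow> bool" where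
  "trig_polynomial_of_degree n f \<longleftrightarrow>
     (\<exists>a b. f = trig_sum a b n \<and> (a n \<noteq> 0 \<or> n \<noteq> 0 \<and> b n \<noteq> 0))"

definition pure_harmonic :: "nat \<Rightarrow> (real \<Rightarrow> real) \<Rightarrow> bool" where
  "pure_harmonic n f \<longleftrightarrow>
     (\<exists>a b. f = (\<lambda>\<alpha>. a * cos (real n * \<alpha>) + b * sin (real n * \<alpha>)))"

definition hypocycloid :: "nat \<Rightarrow> (real \<Rightarrow> real) \<Rightarrow> bool" where
  "hypocycloid n f \<longleftrightarrow> hedgehog f \<and> pure_harmonic n f"

lemma curve_point_inner_dir: "curve_point p \<alpha> \<bullet> dir \<alpha> = p \<alpha>"
  using sin_cos_squared_add[of \<alpha>] unfolding curve_point_def dir_def inner_Pair inner_real_def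
  by algebra

lemma curve_point_has_vector_derivative:
  assumes "smooth p"
  shows "(curve_point p has_vector_derivative curvature_radius p \<alpha> *\<^sub>R dir (\<alpha> + pi / 2)) (at \<alpha>)"
proof -
  have "p differentiable at \<alpha>" "deriv p differentiable at \<alpha>"
    using assms[unfolded smooth_def, rule_format, of 0 \<alpha>]
      assms[unfolded smooth_def, rule_format, of 1 \<alpha>] by simp_all
  then have [derivative_intros]:
    "(p has_field_derivative deriv p \<alpha>) (at \<alpha>)"
    "(deriv p has_field_derivative deriv (deriv p) \<alpha>) (at \<alpha>)"
    by (simp_all add: DERIV_deriv_iff_real_differentiable)
  have "((\<lambda>x. p x * cos x - deriv p x * sin x) has_vector_derivative
          - (curvature_radius p \<alpha> * sin \<alpha>)) (at \<alpha>)"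
    unfolding has_real_derivative_iff_has_vector_derivative[symmetric]
    by (auto intro!: derivative_eq_intros simp: curvature_radius_def algebra_simps)
  moreover have "((\<lambda>x. p x * sin x + deriv p x * cos x) has_vector_derivative
          curvature_radius p \<alpha> * cos \<alpha>) (at \<alpha>)"
    unfolding has_real_derivative_iff_has_vector_derivative[symmetric]
    by (auto intro!: derivative_eq_intros simp: curvature_radius_def algebra_simps)
  ultimately have "((\<lambda>x. (p x * cos x - deriv p x * sin x, p x * sin x + deriv p x * cos x))
      has_vector_derivative
        (- (curvature_radius p \<alpha> * sin \<alpha>), curvature_radius p \<alpha> * cos \<alpha>)) (at \<alpha>)"
    by (rule has_vector_derivative_Pair)
  then show ?thesis
    by (simp add: curve_point_def[abs_def] dir_def cos_add sin_add)
qed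

lemma evolute_eq: "evolute p = (\<lambda>\<alpha>. deriv p (\<alpha> - pi / 2))"
proof
  fix \<beta>
  have eqs: "cos (\<beta> - pi / 2) = sin \<beta>" "sin (\<beta> - pi / 2) = - cos \<beta>"
    by (simp_all add: cos_diff sin_diff)
  show "evolute p \<beta> = deriv p (\<beta> - pi / 2)"
    using sin_cos_squared_add[of \<beta>]
    unfolding evolute_def curve_point_def dir_def inner_Pair inner_real_def eqs by algebra
qed

end

(* Differentiating k times multiplies the j-th harmonic by j^k, so after division by n^k only the top
   harmonic of a trigonometric polynomial survives.

   The curvature radius of the k-th evolute is, up to a shift, the k-th derivative of g = p + p'', so
   the second part is a theorem of Polya and Wiener about the zeros of the derivatives of g.  Counted
   cyclically, Rolle's theorem applied to exp (- l x) f(x) shows that f' - l f has at least as many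
   zeros as f.  Hence D^2 - m^2 = (D + m) (D - m) does not decrease the number of zeros either.
   If the m-th harmonic of g is nonzero, apply (D^2 - m^2)^(2 k) to the function h_k whose n-th
   harmonic is that of g times (4 m^2 n^2 / (n^2 + m^2)^2)^k: the result is a multiple of the
   2k-th derivative of g.  This factor is 1 for n = m and decays for all other n, so h_k converges
   uniformly to the m-th harmonic of g and has at least 2 m zeros for large k. *)

theory Submission
  imports Defs
begin

section \<open>Iterated evolutes and harmonics\<close>

text \<open>Translation carries derivatives at \<open>x - c\<close> to derivatives at
  \<open>x\<close>, so the choice behind \<open>deriv\<close> gives the same value on both sides,
  even where \<open>q\<close> is not differentiable.\<close>

lemma deriv_shift: "deriv (\<lambda>y. q (y - c)) x = deriv q (x - c)" for q :: "real \<Rightarrow> real"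
  using DERIV_shift[of q _ x "- c"] by (simp add: deriv_def)

lemma iterated_evolute_eq:
  "iterated_evolute k p = (\<lambda>x. (deriv ^^ k) p (x - real k * pi / 2))"
proof (induction k)
  case 0
  show ?case by (simp add: iterated_evolute_def)
next
  case (Suc k)
  have "iterated_evolute (Suc k) p = evolute (iterated_evolute k p)"
    by (simp add: iterated_evolute_def)
  also have "\<dots> = (\<lambda>x. (deriv ^^ Suc k) p (x - pi / 2 - real k * pi / 2))"
    unfolding Suc.IH evolute_eq by (simp add: deriv_shift)
  also have "\<dots> = (\<lambda>x. (deriv ^^ Suc k) p (x - real (Suc k) * pi / 2))"
    by (rule ext, rule arg_cong[where f = "(deriv ^^ Suc k) p"]) (simp add: field_simps)
  finally show ?case .
qed

lemma curvature_radius_iterated_evolute: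
  "curvature_radius (iterated_evolute k p) x =
     (deriv ^^ k) p (x - real k * pi / 2) + (deriv ^^ (k + 2)) p (x - real k * pi / 2)"
proof -
  have "deriv (\<lambda>y. (deriv ^^ k) p (y - real k * pi / 2)) =
        (\<lambda>y. deriv ((deriv ^^ k) p) (y - real k * pi / 2))"
    by (rule ext) (rule deriv_shift)
  then show ?thesis
    by (simp add: curvature_radius_def iterated_evolute_eq deriv_shift)
qed

lemma smooth_has_derivative:
  assumes "smooth f"
  shows "((deriv ^^ k) f has_real_derivative (deriv ^^ Suc k) f x) (at x)"
  using assms by (simp add: smooth_def DERIV_deriv_iff_real_differentiable)

lemma deriv_periodic:
  fixes f :: "real \<Rightarrow> real"
  assumes "\<And>x. f (x + c) = f x"
  shows "deriv f (x + c) = deriv f x"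
  using deriv_shift[of f "- c" x] assms by simp

lemma hedgehog_deriv_periodic:
  assumes "hedgehog p"
  shows "(deriv ^^ k) p (x + 2 * pi) = (deriv ^^ k) p x"
  using assms by (induction k arbitrary: x) (auto simp: hedgehog_def intro: deriv_periodic)

text \<open>Keeping a phase \<open>c\<close> avoids exchanging the coefficients: a derivative
  multiplies by \<open>n\<close> and advances the phase by a quarter turn, which iterates at
  once.\<close>

lemma harmonic_has_derivative:
  "((\<lambda>x. a * cos (n * x + c) + b * sin (n * x + c)) has_real_derivative
     n * (a * cos (n * x + (c + pi / 2)) + b * sin (n * x + (c + pi / 2)))) (at x)"
  by (auto intro!: derivative_eq_intros simp: cos_add sin_add algebra_simps)

lemma deriv_harmonic_sum:
  assumes "finite S"
  shows "(deriv ^^ k) (\<lambda>x. \<Sum>j\<in>S. a j * cos (real j * x) + b j * sin (real j * x)) =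
    (\<lambda>x. \<Sum>j\<in>S. real j ^ k * (a j * cos (real j * x + real k * pi / 2) +
                              b j * sin (real j * x + real k * pi / 2)))"
proof (induction k)
  case 0
  show ?case by simp
next
  case (Suc k)
  have "deriv (\<lambda>x. \<Sum>j\<in>S. real j ^ k * (a j * cos (real j * x + real k * pi / 2) +
                              b j * sin (real j * x + real k * pi / 2))) x =
    (\<Sum>j\<in>S. real j ^ k * (real j * (a j * cos (real j * x + (real k * pi / 2 + pi / 2)) +
                              b j * sin (real j * x + (real k * pi / 2 + pi / 2)))))" for x
    by (intro DERIV_imp_deriv DERIV_sum DERIV_cmult harmonic_has_derivative)
  moreover have "real k * pi / 2 + pi / 2 = real (Suc k) * pi / 2"
    by (simp add: field_simps)
  ultimately show ?case
    by (simp only: funpow.simps o_apply Suc.IH power_Suc fun_eq_iff mult.left_commute mult.assoc) simp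
qed

lemma smooth_harmonic_sum:
  assumes "finite S"
  shows "smooth (\<lambda>x. \<Sum>j\<in>S. a j * cos (real j * x) + b j * sin (real j * x))"
  unfolding smooth_def deriv_harmonic_sum[OF assms]
proof (intro allI)
  fix k x
  have "((\<lambda>x. \<Sum>j\<in>S. real j ^ k * (a j * cos (real j * x + real k * pi / 2) +
      b j * sin (real j * x + real k * pi / 2))) has_real_derivative
      (\<Sum>j\<in>S. real j ^ k * (real j * (a j * cos (real j * x + (real k * pi / 2 + pi / 2)) +
      b j * sin (real j * x + (real k * pi / 2 + pi / 2)))))) (at x)"
    by (intro DERIV_sum DERIV_cmult harmonic_has_derivative)
  then show "(\<lambda>x. \<Sum>j\<in>S. real j ^ k * (a j * cos (real j * x + real k * pi / 2) +
      b j * sin (real j * x + real k * pi / 2))) differentiable at x"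
    using real_differentiable_def by blast
qed

lemma cos_periodic_nat: "cos (real n * (x + 2 * pi)) = cos (real n * x)"
  and sin_periodic_nat: "sin (real n * (x + 2 * pi)) = sin (real n * x)"
proof -
  have "real n * (x + 2 * pi) = real n * x + 2 * pi * of_int (int n)"
    by (simp add: algebra_simps)
  then show "cos (real n * (x + 2 * pi)) = cos (real n * x)"
    and "sin (real n * (x + 2 * pi)) = sin (real n * x)"
    using cos.plus_of_int[of "real n * x" "int n"] sin.plus_of_int[of "real n * x" "int n"]
    by (simp_all add: mult_ac)
qed

lemma hypocycloid_harmonic:
  "hypocycloid n (\<lambda>x. a * cos (real n * x) + b * sin (real n * x))"
  using smooth_harmonic_sum[of "{n}" "\<lambda>_. a" "\<lambda>_. b"]
  by (auto simp: hypocycloid_def hedgehog_def pure_harmonic_def cos_periodic_nat sin_periodic_nat)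

text \<open>At 0 the sine vanishes, and at a quarter period the cosine does.\<close>

lemma harmonic_eq_0:
  assumes "\<And>x. a * cos (real n * x) + b * sin (real n * x) = 0"
  shows "a = 0" and "n \<noteq> 0 \<Longrightarrow> b = 0"
  using assms[of 0] assms[of "pi / (2 * real n)"] by simp_all

lemma abs_harmonic_le: "\<bar>a * cos x + b * sin y\<bar> \<le> \<bar>a\<bar> + \<bar>b\<bar>" for a b :: real
proof -
  have "\<bar>a * cos x\<bar> \<le> \<bar>a\<bar>" "\<bar>b * sin y\<bar> \<le> \<bar>b\<bar>"
    by (simp_all add: abs_mult mult_left_le)
  then show ?thesis by linarith
qed

section \<open>Limiting shape for trigonometric polynomials\<close>

lemma evolutes_of_trig_polynomial:
  fixes p :: "real \<Rightarrow> real"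
  assumes n: "n \<ge> 1" and p: "trig_polynomial_of_degree n p"
  shows "\<exists>(c :: nat \<Rightarrow> real) (s :: nat \<Rightarrow> real) f.
     (\<forall>k. c k \<noteq> 0) \<and> hypocycloid n f \<and> f \<noteq> (\<lambda>_. 0) \<and>
     uniform_limit UNIV (\<lambda>k \<alpha>. c k * iterated_evolute k p (\<alpha> + s k)) f sequentially"
proof -
  obtain a b where ab: "p = trig_sum a b n" "a n \<noteq> 0 \<or> b n \<noteq> 0"
    using p by (auto simp: trig_polynomial_of_degree_def)
  \<comment> \<open>\<open>c k\<close> undoes the growth of the top harmonic. The first part of
    \<open>s k\<close> undoes the \<open>k\<close> quarter turns of the evolutes, the second the
    phase \<open>k * pi / 2\<close> of the top harmonic, since
    \<open>n * (k * pi / (2 * n)) = k * pi / 2\<close>.\<close>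
  define c :: "nat \<Rightarrow> real" where "c k = 1 / real n ^ k" for k
  define s :: "nat \<Rightarrow> real" where "s k = real k * pi / 2 - real k * pi / (2 * real n)" for k
  define f where "f x = a n * cos (real n * x) + b n * sin (real n * x)" for x
  define r where "r k j x = (real j / real n) ^ k *
    (a j * cos (real j * (x - real k * pi / (2 * real n)) + real k * pi / 2) +
     b j * sin (real j * (x - real k * pi / (2 * real n)) + real k * pi / 2))" for k j x
  have expand: "c k * iterated_evolute k p (x + s k) = (\<Sum>j<n. r k j x) + f x" for k x
  proof -
    have "p = (\<lambda>x. \<Sum>j\<le>n. a j * cos (real j * x) + b j * sin (real j * x))"
      unfolding ab trig_sum_def ..
    then have "c k * iterated_evolute k p (x + s k) = (\<Sum>j\<le>n. r k j x)"
      by (simp add: iterated_evolute_eq deriv_harmonic_sum s_def c_def r_def sum_divide_distrib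
          power_divide add_diff_eq)
    also have "\<dots> = (\<Sum>j<n. r k j x) + r k n x"
      by (simp add: lessThan_Suc_atMost[symmetric])
    also have "r k n x = f x"
      using n by (simp add: r_def f_def field_simps)
    finally show ?thesis .
  qed
  have "uniform_limit UNIV (\<lambda>k x. \<Sum>j<n. r k j x) (\<lambda>x. 0) sequentially"
  proof (rule uniform_limitI)
    fix e :: real assume "e > 0"
    \<comment> \<open>This majorant of the lower harmonics is free of \<open>x\<close>; each ratio
      \<open>j / n\<close> is below 1, so it decays and the convergence is uniform.\<close>
    have "(\<lambda>k. \<Sum>j<n. (real j / real n) ^ k * (\<bar>a j\<bar> + \<bar>b j\<bar>)) \<longlonglongrightarrow> (\<Sum>j<n. 0 * (\<bar>a j\<bar> + \<bar>b j\<bar>))"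
      by (intro tendsto_sum tendsto_mult tendsto_const LIMSEQ_realpow_zero) auto
    then have "eventually (\<lambda>k. (\<Sum>j<n. (real j / real n) ^ k * (\<bar>a j\<bar> + \<bar>b j\<bar>)) < e) sequentially"
      using \<open>e > 0\<close> by (intro order_tendstoD(2)) auto
    then show "\<forall>\<^sub>F k in sequentially. \<forall>x\<in>UNIV. dist (\<Sum>j<n. r k j x) 0 < e"
    proof eventually_elim
      case (elim k)
      have "\<bar>r k j x\<bar> \<le> (real j / real n) ^ k * (\<bar>a j\<bar> + \<bar>b j\<bar>)" for j x
        unfolding r_def abs_mult by (simp add: mult_left_mono abs_harmonic_le)
      then have "\<bar>\<Sum>j<n. r k j x\<bar> \<le> (\<Sum>j<n. (real j / real n) ^ k * (\<bar>a j\<bar> + \<bar>b j\<bar>))" for x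
        by (intro sum_abs[THEN order_trans] sum_mono)
      with elim show ?case
        by (auto simp: intro: le_less_trans)
    qed
  qed
  then have "uniform_limit UNIV (\<lambda>k x. (\<Sum>j<n. r k j x) + f x) (\<lambda>x. 0 + f x) sequentially"
    by (intro uniform_limit_add uniform_limit_const)
  then have "uniform_limit UNIV (\<lambda>k x. c k * iterated_evolute k p (x + s k)) f sequentially"
    by (simp add: expand)
  moreover have "hypocycloid n f"
    unfolding f_def by (rule hypocycloid_harmonic)
  moreover have "f \<noteq> (\<lambda>_. 0)"
    using ab(2) n harmonic_eq_0[of "a n" n "b n"] by (auto simp: f_def fun_eq_iff)
  moreover have "\<forall>k. c k \<noteq> 0"
    using n by (simp add: c_def)
  ultimately show ?thesis by blast
qed

section \<open>Cyclic zeros and Rolle's theorem\<close>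

text \<open>The function is meant to be \<open>2 * pi\<close>-periodic; \<open>x 0, ..., x (N - 1)\<close> are distinct zeros modulo \<open>2 * pi\<close>.\<close>

definition cyclic_zeros :: "nat \<Rightarrow> (real \<Rightarrow> real) \<Rightarrow> bool" where
  "cyclic_zeros N g \<longleftrightarrow> (\<exists>x. (\<forall>i<N. x i < x (Suc i)) \<and> x N = x 0 + 2 * pi \<and> (\<forall>i<N. g (x i) = 0))"

lemma cyclic_zeros_0: "\<not> cyclic_zeros 0 g"
  by (simp add: cyclic_zeros_def)

lemma less_of_less_Suc:
  fixes x :: "nat \<Rightarrow> real"
  assumes "\<And>i. i < N \<Longrightarrow> x i < x (Suc i)" "i < j" "j \<le> N"
  shows "x i < x j"
  using assms(2,3)
proof (induction j)
  case (Suc j)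
  then show ?case
    using assms(1)[of j] by (cases "i = j") force+
qed simp

text \<open>One zero in each open gap of a cyclic partition gives a cyclic family again. This serves
  both Rolle's theorem and the sign changes of a near-harmonic function.\<close>

lemma cyclic_zeros_between:
  fixes x :: "nat \<Rightarrow> real"
  assumes N: "N > 0"
    and x: "\<And>i. i < N \<Longrightarrow> x i < x (Suc i)" "x N = x 0 + 2 * pi"
    and z: "\<And>i. i < N \<Longrightarrow> \<exists>z. x i < z \<and> z < x (Suc i) \<and> g z = 0"
  shows "cyclic_zeros N g"
proof -
  obtain y where y: "\<And>i. i < N \<Longrightarrow> x i < y i \<and> y i < x (Suc i) \<and> g (y i) = 0"
    using z by metis
  \<comment> \<open>The closing entry has to be the translate of the first zero. It exceeds the last
    zero because \<open>y 0 + 2 * pi\<close> lies beyond \<open>x N = x 0 + 2 * pi\<close>.\<close>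
  define z where "z i = (if i < N then y i else y 0 + 2 * pi)" for i
  have "z i < z (Suc i)" if i: "i < N" for i
  proof (cases "Suc i < N")
    case True
    then show ?thesis using y[of i] y[of "Suc i"] by (simp add: z_def)
  next
    case False
    with i have "Suc i = N" by simp
    then show ?thesis using y[of i] y[of 0] x(2) N by (simp add: z_def)
  qed
  then show ?thesis
    unfolding cyclic_zeros_def using y N by (intro exI[of _ z]) (auto simp: z_def)
qed

text \<open>The integrating factor \<open>exp (- l * x)\<close> never vanishes, so it changes
  neither the zeros of \<open>g\<close> nor those of \<open>g' - l * g\<close>, which appears in the
  derivative of the product.\<close>

lemma Rolle_exp:
  fixes g :: "real \<Rightarrow> real"
  assumes "u < v" "g u = 0" "g v = 0" and D: "\<And>x. (g has_real_derivative g' x) (at x)"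
  shows "\<exists>z. u < z \<and> z < v \<and> g' z - l * g z = 0"
proof -
  let ?f = "\<lambda>x. exp (- l * x) * g x"
  have D': "(?f has_real_derivative exp (- l * x) * (g' x - l * g x)) (at x)" for x
    by (auto intro!: derivative_eq_intros D simp: algebra_simps)
  have cont: "continuous_on {u..v} ?f"
    by (rule DERIV_continuous_on[OF has_field_derivative_at_within[OF D']])
  \<comment> \<open>Here Rolle's theorem says that the derivative, as a linear map, is zero; its
    value at \<open>h = 1\<close> is the number wanted.\<close>
  have "\<exists>z. u < z \<and> z < v \<and> (\<lambda>h. exp (- l * z) * (g' z - l * g z) * h) = (\<lambda>h. 0)"
    using assms(1-3) D' by (intro Rolle_deriv[where f = ?f] cont) (auto simp: has_field_derivative_def)
  then obtain z where z: "u < z" "z < v" "\<And>h. exp (- l * z) * (g' z - l * g z) * h = 0"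
    by metis
  show ?thesis
    using z(1,2) z(3)[of 1] by auto
qed

lemma cyclic_zeros_deriv:
  assumes Z: "cyclic_zeros N g" and per: "\<And>x. g (x + 2 * pi) = g x"
    and D: "\<And>x. (g has_real_derivative g' x) (at x)"
  shows "cyclic_zeros N (\<lambda>x. g' x - l * g x)"
proof -
  obtain x where x: "\<And>i. i < N \<Longrightarrow> x i < x (Suc i)" "x N = x 0 + 2 * pi"
     "\<And>i. i < N \<Longrightarrow> g (x i) = 0"
    using Z by (auto simp: cyclic_zeros_def)
  have N: "N > 0" using Z cyclic_zeros_0 by (cases N) auto
  \<comment> \<open>Periodicity supplies the zero at the closing index \<open>N\<close>, so the last
    gap also has zeros at both ends and no zero is lost.\<close>
  have x': "g (x i) = 0" if "i \<le> N" for i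
    using that x(2) x(3)[of i] x(3)[of 0] per[of "x 0"] N by (cases "i = N") auto
  show ?thesis
  proof (rule cyclic_zeros_between)
    fix i assume i: "i < N"
    then show "\<exists>z>x i. z < x (Suc i) \<and> g' z - l * g z = 0"
      using x x'[of "Suc i"] by (intro Rolle_exp D) auto
  qed (use N x in auto)
qed

lemma cyclic_zeros_shift:
  assumes "cyclic_zeros N g"
  shows "cyclic_zeros N (\<lambda>x. g (x - c))"
proof -
  obtain x where "(\<forall>i<N. x i < x (Suc i)) \<and> x N = x 0 + 2 * pi \<and> (\<forall>i<N. g (x i) = 0)"
    using assms by (auto simp: cyclic_zeros_def)
  then show ?thesis
    unfolding cyclic_zeros_def by (intro exI[of _ "\<lambda>i. x i + c"]) auto
qed

lemma periodic_int_multiple: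
  fixes g :: "real \<Rightarrow> 'a"
  assumes "\<And>x. g (x + 2 * pi) = g x"
  shows "g (x + 2 * pi * of_int k) = g x"
proof -
  interpret periodic_fun_simple g "2 * pi" by standard (rule assms)
  show ?thesis using plus_of_int[of x k] by (simp add: mult.commute)
qed

text \<open>Reducing the zeros modulo \<open>2 * pi\<close> into the fundamental interval is
  injective: two of them with equal residues would differ by a positive multiple of
  \<open>2 * pi\<close>, but they lie less than one period apart.\<close>

lemma cyclic_zeros_le_num_cusps:
  assumes "cyclic_zeros N (curvature_radius p)"
    and per: "\<And>x. curvature_radius p (x + 2 * pi) = curvature_radius p x"
  shows "enat N \<le> num_cusps p"
proof (cases "finite (cusps p)")
  case fin: True
  obtain x where x: "\<And>i. i < N \<Longrightarrow> x i < x (Suc i)" "x N = x 0 + 2 * pi"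
     "\<And>i. i < N \<Longrightarrow> curvature_radius p (x i) = 0"
    using assms by (auto simp: cyclic_zeros_def)
  define t where "t i = \<lfloor>x i / (2 * pi)\<rfloor>" for i
  define y where "y i = x i - 2 * pi * of_int (t i)" for i
  have mono: "x i < x j" if "i < j" "j \<le> N" for i j
    using less_of_less_Suc[of N x, OF x(1) that] by simp
  have "y i \<in> cusps p" if "i < N" for i
  proof -
    have "curvature_radius p (y i) = 0"
      using periodic_int_multiple[of "curvature_radius p" "y i" "t i", OF per] x(3)[OF that]
      by (simp add: y_def)
    moreover have "of_int (t i) \<le> x i / (2 * pi)" "x i / (2 * pi) < of_int (t i) + 1"
      by (simp_all add: t_def)
    then have "0 \<le> y i" "y i < 2 * pi"
      by (simp_all add: y_def field_simps)
    ultimately show ?thesis by (simp add: cusps_def)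
  qed
  moreover have "y i \<noteq> y j" if ij: "i < j" "j < N" for i j
  proof
    assume "y i = y j"
    then have *: "x j - x i = 2 * pi * of_int (t j - t i)" by (simp add: y_def algebra_simps)
    have "x i < x j" "x j < x N" "x 0 \<le> x i"
      using mono[of i j] mono[of j N] mono[of 0 i] ij by (cases "i = 0"; simp)+
    with x(2) have "0 < x j - x i" "x j - x i < 2 * pi * 1" by auto
    then have "0 < t j - t i" "t j - t i < 1"
      unfolding * by (simp_all add: zero_less_mult_iff)
    then show False by simp
  qed
  then have "inj_on y {..<N}"
    by (intro inj_onI) (metis lessThan_iff nat_neq_iff)
  ultimately have "card {..<N} \<le> card (cusps p)"
    by (intro card_inj_on_le[of y] fin) auto
  then show ?thesis using fin by (simp add: num_cusps_def)
qed (simp add: num_cusps_def)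

text \<open>The harmonic has amplitude \<open>sqrt (a^2 + b^2)\<close> and attains its extrema with
  alternating signs at \<open>2 * m\<close> points per period. An error below the amplitude
  preserves these signs, so every gap contains a zero.\<close>

lemma cyclic_zeros_near_harmonic:
  fixes g :: "real \<Rightarrow> real"
  assumes m: "m > 0" and ab: "a \<noteq> 0 \<or> b \<noteq> 0"
    and g: "continuous_on UNIV g"
    and near: "\<And>x. \<bar>g x - (a * cos (real m * x) + b * sin (real m * x))\<bar> < sqrt (a\<^sup>2 + b\<^sup>2)"
  shows "cyclic_zeros (2 * m) g"
proof -
  define R where "R = sqrt (a\<^sup>2 + b\<^sup>2)"
  have R: "R > 0" using ab by (simp add: R_def sum_power2_gt_zero_iff)
  have "R\<^sup>2 = a\<^sup>2 + b\<^sup>2" by (simp add: R_def)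
  then have "(a / R)\<^sup>2 + (b / R)\<^sup>2 = R\<^sup>2 / R\<^sup>2"
    by (simp only: power_divide add_divide_distrib)
  also have "\<dots> = 1" using R by simp
  finally have "(a / R)\<^sup>2 + (b / R)\<^sup>2 = 1" .
  then obtain t where t: "a / R = cos t" "b / R = sin t"
    using sincos_total_2pi[of "a / R" "b / R"] by metis
  \<comment> \<open>The extremal points of \<open>R * cos (m * x - t)\<close>, where
    \<open>t\<close> is the polar angle of \<open>(a, b)\<close>.\<close>
  define x where "x i = (t + real i * pi) / real m" for i
  have x: "a * cos (real m * x i) + b * sin (real m * x i) = (-1) ^ i * R" for i
  proof -
    have ab': "a = R * cos t" "b = R * sin t" using t R by (simp_all add: field_simps)
    have "a * cos (real m * x i) + b * sin (real m * x i) = R * cos (real m * x i - t)"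
      unfolding ab' cos_diff by (simp add: algebra_simps)
    also have "real m * x i - t = pi * real i" using m by (simp add: x_def)
    finally show ?thesis by (simp add: cos_npi2)
  qed
  show ?thesis
  proof (rule cyclic_zeros_between[of _ x])
    show "x i < x (Suc i)" for i
      using m by (simp add: x_def divide_simps algebra_simps)
    show "x (2 * m) = x 0 + 2 * pi"
      using m by (simp add: x_def field_simps)
    fix i
    have lt: "x i < x (Suc i)"
      using m by (simp add: x_def divide_simps algebra_simps)
    have cont: "continuous_on {x i..x (Suc i)} g"
      using g continuous_on_subset by blast
    have n: "\<bar>g (x i) - (-1) ^ i * R\<bar> < R" "\<bar>g (x (Suc i)) + (-1) ^ i * R\<bar> < R"
      using near[of "x i"] near[of "x (Suc i)"] unfolding x R_def[symmetric] by simp_all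
    \<comment> \<open>The intermediate value theorem only locates a zero in the closed gap; that
      \<open>g\<close> is nonzero at both ends moves it into the open one.\<close>
    have "\<exists>z\<ge>x i. z \<le> x (Suc i) \<and> g z = 0 \<and> g (x i) \<noteq> 0 \<and> g (x (Suc i)) \<noteq> 0"
    proof (cases "even i")
      case True
      with n have "g (x i) > 0" "g (x (Suc i)) < 0" by auto
      then show ?thesis using IVT2'[of g "x (Suc i)" 0 "x i"] cont lt by auto
    next
      case False
      with n have "g (x i) < 0" "g (x (Suc i)) > 0" by auto
      then show ?thesis using IVT'[of g "x i" 0 "x (Suc i)"] cont lt by auto
    qed
    then show "\<exists>z>x i. z < x (Suc i) \<and> g z = 0"
      by (metis order_le_less)
  qed (use m in auto)
qed

section \<open>Approximation by trigonometric polynomials\<close>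

text \<open>An inductive counterpart of \<open>trig_polynomial\<close>: closure under products and
  orthogonality then follow by rule induction, without handling coefficients.\<close>

inductive trig :: "(real \<Rightarrow> real) \<Rightarrow> bool" where
  cos: "trig (\<lambda>x. cos (real n * x))"
| sin: "trig (\<lambda>x. sin (real n * x))"
| add: "trig f \<Longrightarrow> trig g \<Longrightarrow> trig (\<lambda>x. f x + g x)"
| scale: "trig f \<Longrightarrow> trig (\<lambda>x. c * f x)"

text \<open>Product-to-sum formulas produce the frequency \<open>n - m\<close>, which may be
  negative; parity makes it natural again.\<close>

lemma trig_cos_int: "trig (\<lambda>x. cos (of_int k * x))"
proof (cases "k \<ge> 0")
  case True
  then show ?thesis using trig.cos[of "nat k"] by simp
next
  case False
  then show ?thesis using trig.cos[of "nat (- k)"] by simp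
qed

lemma trig_sin_int: "trig (\<lambda>x. sin (of_int k * x))"
proof (cases "k \<ge> 0")
  case True
  then show ?thesis using trig.sin[of "nat k"] by simp
next
  case False
  then show ?thesis using trig.scale[OF trig.sin[of "nat (- k)"], of "-1"] by simp
qed

lemma trig_diff: "trig f \<Longrightarrow> trig g \<Longrightarrow> trig (\<lambda>x. f x - g x)"
  using trig.add[OF _ trig.scale[of g "-1"], of f] by simp

lemma
  shows cos_mult_cos_nat: "cos (real n * x) * cos (real m * x) =
      1 / 2 * (cos (of_int (int n - int m) * x) + cos (of_int (int n + int m) * x))"
    and sin_mult_sin_nat: "sin (real n * x) * sin (real m * x) =
      1 / 2 * (cos (of_int (int n - int m) * x) - cos (of_int (int n + int m) * x))"
    and sin_mult_cos_nat: "sin (real n * x) * cos (real m * x) =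
      1 / 2 * (sin (of_int (int n + int m) * x) + sin (of_int (int n - int m) * x))"
  by (simp_all add: left_diff_distrib distrib_right cos_add cos_diff sin_add sin_diff)

lemma trig_cos_cos: "trig (\<lambda>x. cos (real n * x) * cos (real m * x))"
  unfolding cos_mult_cos_nat by (intro trig.scale trig.add trig_cos_int)

lemma trig_sin_sin: "trig (\<lambda>x. sin (real n * x) * sin (real m * x))"
  unfolding sin_mult_sin_nat by (intro trig.scale trig_diff trig_cos_int)

lemma trig_sin_cos: "trig (\<lambda>x. sin (real n * x) * cos (real m * x))"
  unfolding sin_mult_cos_nat by (intro trig.scale trig.add trig_sin_int)

text \<open>By bilinearity, a nested induction reduces the claim to products of two basic harmonics,
  which the product-to-sum formulas settle.\<close>

lemma trig_mult:
  assumes "trig f" "trig g"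
  shows "trig (\<lambda>x. f x * g x)"
  using assms(1)
proof induction
  case (cos n)
  show ?case using assms(2)
  proof induction
    case (cos m)
    show ?case by (rule trig_cos_cos)
  next
    case (sin m)
    show ?case using trig_sin_cos[of m n] by (simp add: mult.commute)
  qed (auto simp: distrib_left mult.left_commute intro: trig.intros)
next
  case (sin n)
  show ?case using assms(2)
  proof induction
    case (cos m)
    show ?case by (rule trig_sin_cos)
  next
    case (sin m)
    show ?case by (rule trig_sin_sin)
  qed (auto simp: distrib_left mult.left_commute intro: trig.intros)
qed (auto simp: distrib_right mult.assoc intro: trig.intros)

lemma trig_const: "trig (\<lambda>x. c)"
  using trig.scale[OF trig.cos[of 0], of c] by simp

text \<open>On the unit circle a real-linear functional is a combination of cosine and sine; sums
  and products are covered by closure.\<close>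

lemma trig_real_polynomial_function:
  fixes g :: "complex \<Rightarrow> real"
  assumes "real_polynomial_function g"
  shows "trig (\<lambda>x. g (cis x))"
  using assms
proof induction
  case (linear f)
  interpret bounded_linear f by (rule linear)
  have "f (cis x) = f 1 * cos (real 1 * x) + f \<i> * sin (real 1 * x)" for x
  proof -
    have "cis x = cos x *\<^sub>R 1 + sin x *\<^sub>R \<i>" by (simp add: complex_eq_iff)
    then have "f (cis x) = cos x *\<^sub>R f 1 + sin x *\<^sub>R f \<i>" by (simp only: add scaleR)
    then show ?thesis by simp
  qed
  then show ?case
    by (simp only:) (intro trig.intros)
qed (auto intro: trig_const trig.add trig_mult)

section \<open>Periodic functions as functions on the unit circle\<close>

lemma periodic_cis_cong:
  fixes f :: "real \<Rightarrow> 'a"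
  assumes per: "\<And>x. f (x + 2 * pi) = f x" and eq: "cis x = cis y"
  shows "f x = f y"
proof -
  have "sin x = sin y \<and> cos x = cos y" using eq by (simp add: complex_eq_iff)
  then obtain k :: int where "x = y + 2 * pi * of_int k"
    unfolding sin_cos_eq_iff by blast
  then show ?thesis by (simp add: periodic_int_multiple[of f, OF per])
qed

text \<open>\<open>Arg\<close> jumps across the negative real axis. There \<open>Arg2pi\<close> is
  continuous, and a periodic \<open>f\<close> does not see the difference between the two
  arguments.\<close>

lemma continuous_on_Arg_periodic:
  fixes f :: "real \<Rightarrow> real"
  assumes f: "continuous_on UNIV f" and per: "\<And>x. f (x + 2 * pi) = f x"
  shows "continuous_on (- {0}) (\<lambda>z. f (Arg z))"
proof -
  have c: "isCont f x" for x using f by (simp add: continuous_on_eq_continuous_at)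
  have "isCont (\<lambda>z. f (Arg z)) z" if z: "z \<noteq> 0" for z
  proof (cases "z \<in> \<real>\<^sub>\<le>\<^sub>0")
    case False
    then show ?thesis by (intro isCont_o2[of _ Arg f] continuous_at_Arg c)
  next
    case True
    have "f (Arg w) = f (Arg2pi w)" for w
    proof (cases "w = 0")
      case False
      then have "cis (Arg w) = w / of_real (cmod w)" by (simp add: cis_Arg sgn_eq)
      also have "\<dots> = cis (Arg2pi w)"
        using Arg2pi_eq[of w] False by (simp add: cis_conv_exp divide_eq_eq mult.commute)
      finally show ?thesis by (rule periodic_cis_cong[of f, OF per])
    qed (simp add: Arg_zero)
    moreover have "z \<notin> \<real>\<^sub>\<ge>\<^sub>0"
      using True z by (auto simp: complex_nonneg_Reals_iff complex_nonpos_Reals_iff complex_eq_iff)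
    then have "isCont (\<lambda>z. f (Arg2pi z)) z"
      by (intro isCont_o2[of _ Arg2pi f] continuous_at_Arg2pi c)
    ultimately show ?thesis by simp
  qed
  then show ?thesis
    by (simp add: continuous_on_eq_continuous_at open_Compl)
qed

text \<open>Stone-Weierstrass on the unit circle, to which \<open>f\<close> descends by
  periodicity.\<close>

lemma trig_approximation:
  fixes f :: "real \<Rightarrow> real"
  assumes f: "continuous_on UNIV f" and per: "\<And>x. f (x + 2 * pi) = f x" and e: "e > 0"
  obtains g where "trig g" "\<And>x. \<bar>f x - g x\<bar> < e"
proof -
  have "continuous_on (sphere 0 1) (\<lambda>z. f (Arg z))"
    by (rule continuous_on_subset[OF continuous_on_Arg_periodic[OF f per]]) auto
  then obtain g where g: "real_polynomial_function g" "\<And>z. z \<in> sphere 0 1 \<Longrightarrow> \<bar>f (Arg z) - g z\<bar> < e"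
    using Stone_Weierstrass_real_polynomial_function[of "sphere 0 1" "\<lambda>z. f (Arg z)" e] e
    by (metis compact_sphere)
  have "f (Arg (cis x)) = f x" for x
    by (rule periodic_cis_cong[of f, OF per]) (simp add: cis_Arg)
  then have "\<bar>f x - g (cis x)\<bar> < e" for x
    using g(2)[of "cis x"] by simp
  then show ?thesis
    using that[of "\<lambda>x. g (cis x)"] trig_real_polynomial_function[OF g(1)] by blast
qed

lemma trig_continuous: "trig g \<Longrightarrow> continuous_on S g"
  by (induction rule: trig.induct) (auto intro!: continuous_intros)

text \<open>A function with zero coefficients is orthogonal to every trigonometric polynomial, hence
  to uniform approximations of itself. This forces its square to have integral zero.\<close>

lemma eq_0_if_Fourier_coefficients_0:
  fixes d :: "real \<Rightarrow> real"
  assumes d: "continuous_on UNIV d" and per: "\<And>x. d (x + 2 * pi) = d x"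
    and c: "\<And>n. integral {0..2 * pi} (\<lambda>x. d x * cos (real n * x)) = 0"
    and s: "\<And>n. integral {0..2 * pi} (\<lambda>x. d x * sin (real n * x)) = 0"
  shows "d x = 0"
proof -
  have d': "continuous_on S d" for S using d continuous_on_subset by blast
  have int: "f integrable_on {0..2 * pi}" if "continuous_on {0..2 * pi} f" for f :: "real \<Rightarrow> real"
    using that by (rule integrable_continuous_real)
  have orth: "integral {0..2 * pi} (\<lambda>x. d x * g x) = 0" if "trig g" for g
    using that
  proof induction
    case (add f g)
    have "integral {0..2 * pi} (\<lambda>x. d x * f x + d x * g x) =
      integral {0..2 * pi} (\<lambda>x. d x * f x) + integral {0..2 * pi} (\<lambda>x. d x * g x)"
      by (intro integral_add int continuous_intros d' trig_continuous add)
    then show ?case by (simp add: distrib_left add)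
  qed (simp_all add: c s mult.left_commute)
  have small: "integral {0..2 * pi} (\<lambda>x. (d x)\<^sup>2) \<le> 2 * pi * e" if e: "e > 0" for e
  proof -
    obtain g where g: "trig g" "\<And>x. \<bar>d x - g x\<bar> < sqrt e"
      using trig_approximation[OF d per, of "sqrt e"] e by (metis real_sqrt_gt_zero)
    have "integral {0..2 * pi} (\<lambda>x. (d x)\<^sup>2) \<le> integral {0..2 * pi} (\<lambda>x. e + 2 * (d x * g x))"
    proof (intro integral_le int continuous_intros d' trig_continuous g(1))
      fix x
      \<comment> \<open>Expanding the square and dropping \<open>(g x)^2\<close> leaves
        \<open>e\<close> plus a term that integrates to zero by \<open>orth\<close>.\<close>
      have "(d x - g x)\<^sup>2 \<le> e"
        using power_mono[OF less_imp_le[OF g(2)[of x]], of 2] e by simp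
      then show "(d x)\<^sup>2 \<le> e + 2 * (d x * g x)"
        using zero_le_power2[of "g x"] unfolding power2_diff by linarith
    qed
    also have "\<dots> = integral {0..2 * pi} (\<lambda>x. e) + integral {0..2 * pi} (\<lambda>x. 2 * (d x * g x))"
      by (intro integral_add int continuous_intros d' trig_continuous g(1))
    also have "\<dots> = 2 * pi * e"
      using orth[OF g(1)] by simp
    finally show ?thesis .
  qed
  have "integral {0..2 * pi} (\<lambda>x. (d x)\<^sup>2) \<le> 0"
  proof (rule field_le_epsilon)
    fix e :: real assume "e > 0"
    then show "integral {0..2 * pi} (\<lambda>x. (d x)\<^sup>2) \<le> 0 + e"
      using small[of "e / (2 * pi)"] by simp
  qed
  moreover have "integral {0..2 * pi} (\<lambda>x. (d x)\<^sup>2) \<ge> 0"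
    by (intro integral_nonneg int continuous_intros d') auto
  ultimately have "integral {0..2 * pi} (\<lambda>x. (d x)\<^sup>2) = 0" by simp
  moreover have "continuous_on {0..2 * pi} (\<lambda>x. (d x)\<^sup>2)"
    by (intro continuous_intros d')
  ultimately have zero: "d y = 0" if "y \<in> {0..2 * pi}" for y
    using integral_eq_0_iff[of 0 "2 * pi" "\<lambda>x. (d x)\<^sup>2"] that by simp
  \<comment> \<open>\<open>Arg2pi (cis x)\<close> is the representative of \<open>x\<close> in
    \<open>{0..<2 * pi}\<close>, where vanishing is already known.\<close>
  have "cis x = cis (Arg2pi (cis x))"
    using Arg2pi_eq[of "cis x"] by (simp add: cis_conv_exp)
  then have "d x = d (Arg2pi (cis x))"
    by (rule periodic_cis_cong[of d, OF per])
  also have "\<dots> = 0"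
    using Arg2pi_ge_0 Arg2pi_lt_2pi[of "cis x"] by (intro zero) auto
  finally show ?thesis .
qed

section \<open>Fourier series\<close>

definition Fourier_series :: "(nat \<Rightarrow> real) \<Rightarrow> (nat \<Rightarrow> real) \<Rightarrow> real \<Rightarrow> real" where
  "Fourier_series a b x = (\<Sum>n. a n * cos (real n * x) + b n * sin (real n * x))"

text \<open>Summability of all moments is exactly what repeated termwise differentiation requires,
  and it is stable under comparison. As \<open>0 ^ 0 = 1\<close>, the case \<open>j = 0\<close> is
  absolute summability including the term \<open>n = 0\<close>.\<close>

definition rapidly_decreasing :: "(nat \<Rightarrow> real) \<Rightarrow> bool" where
  "rapidly_decreasing c \<longleftrightarrow> (\<forall>j. summable (\<lambda>n. real n ^ j * \<bar>c n\<bar>))"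

lemma rapidly_decreasing_summable: "rapidly_decreasing c \<Longrightarrow> summable (\<lambda>n. \<bar>c n\<bar>)"
  unfolding rapidly_decreasing_def by (drule spec[of _ 0]) simp

lemma rapidly_decreasing_mult_nat:
  assumes "rapidly_decreasing c"
  shows "rapidly_decreasing (\<lambda>n. real n * c n)"
  unfolding rapidly_decreasing_def
proof
  fix j
  show "summable (\<lambda>n. real n ^ j * \<bar>real n * c n\<bar>)"
    using assms[unfolded rapidly_decreasing_def, rule_format, of "Suc j"]
    by (simp add: abs_mult mult_ac)
qed

lemma rapidly_decreasing_bounded_mult:
  assumes "rapidly_decreasing c" "\<And>n. \<bar>l n\<bar> \<le> 1"
  shows "rapidly_decreasing (\<lambda>n. l n * c n)"
  unfolding rapidly_decreasing_def
proof
  fix j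
  show "summable (\<lambda>n. real n ^ j * \<bar>l n * c n\<bar>)"
  proof (rule summable_comparison_test')
    show "summable (\<lambda>n. real n ^ j * \<bar>c n\<bar>)"
      using assms(1) by (simp add: rapidly_decreasing_def)
    show "norm (real n ^ j * \<bar>l n * c n\<bar>) \<le> real n ^ j * \<bar>c n\<bar>" for n
      using assms(2)[of n] by (simp add: abs_mult mult_left_mono mult_left_le_one_le)
  qed
qed

lemma rapidly_decreasing_cmult:
  assumes "rapidly_decreasing c"
  shows "rapidly_decreasing (\<lambda>n. l * c n)"
  using assms by (auto simp: rapidly_decreasing_def abs_mult mult.left_commute[of _ "\<bar>l\<bar>"] intro: summable_mult)

lemma rapidly_decreasing_add:
  assumes "rapidly_decreasing c" "rapidly_decreasing d"
  shows "rapidly_decreasing (\<lambda>n. c n + d n)"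
  unfolding rapidly_decreasing_def
proof
  fix j
  show "summable (\<lambda>n. real n ^ j * \<bar>c n + d n\<bar>)"
  proof (rule summable_comparison_test')
    show "summable (\<lambda>n. real n ^ j * \<bar>c n\<bar> + real n ^ j * \<bar>d n\<bar>)"
      using assms by (intro summable_add) (auto simp: rapidly_decreasing_def)
    show "norm (real n ^ j * \<bar>c n + d n\<bar>) \<le> real n ^ j * \<bar>c n\<bar> + real n ^ j * \<bar>d n\<bar>" for n
      by (simp add: abs_mult distrib_left[symmetric] mult_left_mono abs_triangle_ineq)
  qed
qed

lemma Fourier_series_summable:
  assumes "summable (\<lambda>n. \<bar>a n\<bar>)" "summable (\<lambda>n. \<bar>b n\<bar>)"
  shows "summable (\<lambda>n. a n * cos (real n * x) + b n * sin (real n * x))"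
  using abs_harmonic_le by (intro summable_comparison_test'[OF summable_add[OF assms]]) simp

lemma Fourier_series_uniform_limit:
  assumes "summable (\<lambda>n. \<bar>a n\<bar>)" "summable (\<lambda>n. \<bar>b n\<bar>)"
  shows "uniform_limit S (\<lambda>N x. \<Sum>n<N. a n * cos (real n * x) + b n * sin (real n * x))
           (Fourier_series a b) sequentially"
proof -
  have "Fourier_series a b = (\<lambda>x. \<Sum>n. a n * cos (real n * x) + b n * sin (real n * x))"
    by (simp add: fun_eq_iff Fourier_series_def)
  then show ?thesis
    using abs_harmonic_le by (simp only:) (intro Weierstrass_m_test[OF _ summable_add[OF assms]], simp)
qed

lemma Fourier_series_continuous:
  assumes "summable (\<lambda>n. \<bar>a n\<bar>)" "summable (\<lambda>n. \<bar>b n\<bar>)"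
  shows "continuous_on S (Fourier_series a b)"
  by (rule uniform_limit_theorem[OF _ Fourier_series_uniform_limit[OF assms]])
     (auto intro!: continuous_intros always_eventually)

lemma Fourier_series_periodic: "Fourier_series a b (x + 2 * pi) = Fourier_series a b x"
  by (simp only: Fourier_series_def cos_periodic_nat sin_periodic_nat)

text \<open>Rapid decay makes the differentiated series converge uniformly, which justifies termwise
  differentiation.\<close>

lemma Fourier_series_has_derivative:
  assumes a: "rapidly_decreasing a" and b: "rapidly_decreasing b"
  shows "(Fourier_series a b has_real_derivative
           Fourier_series (\<lambda>n. real n * b n) (\<lambda>n. - (real n * a n)) x) (at x)"
proof -
  let ?f' = "\<lambda>n x. real n * b n * cos (real n * x) + - (real n * a n) * sin (real n * x)"
  have "uniform_limit UNIV (\<lambda>N x. \<Sum>n<N. ?f' n x)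
          (Fourier_series (\<lambda>n. real n * b n) (\<lambda>n. - (real n * a n))) sequentially"
    using rapidly_decreasing_summable[OF rapidly_decreasing_mult_nat] a b
    by (intro Fourier_series_uniform_limit) auto
  then have *: "uniformly_convergent_on UNIV (\<lambda>N x. \<Sum>n<N. ?f' n x)"
    by (auto simp: uniformly_convergent_on_def)
  have "((\<lambda>x. \<Sum>n. a n * cos (real n * x) + b n * sin (real n * x))
     has_real_derivative (\<Sum>n. ?f' n x)) (at x)"
  proof (rule has_field_derivative_series'(2)[of UNIV _ _ 0, OF _ _ *])
    show "summable (\<lambda>n. a n * cos (real n * 0) + b n * sin (real n * 0))"
      by (intro Fourier_series_summable rapidly_decreasing_summable a b)
  qed (auto intro!: derivative_eq_intros simp: algebra_simps)
  then show ?thesis by (simp add: Fourier_series_def[abs_def])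
qed

lemma Fourier_series_cmult:
  assumes "rapidly_decreasing a" "rapidly_decreasing b"
  shows "Fourier_series (\<lambda>n. c * a n) (\<lambda>n. c * b n) x = c * Fourier_series a b x"
  using suminf_mult[OF Fourier_series_summable[OF assms[THEN rapidly_decreasing_summable], of x], of c]
  by (simp add: Fourier_series_def distrib_left mult.assoc)

lemma Fourier_series_add:
  assumes "rapidly_decreasing a" "rapidly_decreasing b" "rapidly_decreasing a'" "rapidly_decreasing b'"
  shows "Fourier_series (\<lambda>n. a n + a' n) (\<lambda>n. b n + b' n) x =
    Fourier_series a b x + Fourier_series a' b' x"
  using suminf_add[OF Fourier_series_summable[OF assms(1,2)[THEN rapidly_decreasing_summable]]
      Fourier_series_summable[OF assms(3,4)[THEN rapidly_decreasing_summable]], of x x]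
  by (simp add: Fourier_series_def distrib_right add_ac)

section \<open>Orthogonality relations and termwise integration\<close>

lemma
  shows has_integral_cos_int: "((\<lambda>x. cos (of_int k * x)) has_integral (if k = 0 then 2 * pi else 0)) {0..2 * pi}"
    and has_integral_sin_int: "((\<lambda>x. sin (of_int k * x)) has_integral 0) {0..2 * pi}"
proof -
  have [simp]: "sin (of_int k * (2 * pi)) = 0" "cos (of_int k * (2 * pi)) = 1"
    using sin.plus_of_int[of "0::real" k] cos.plus_of_int[of "0::real" k] by (simp_all add: mult_ac)
  show "((\<lambda>x. cos (of_int k * x)) has_integral (if k = 0 then 2 * pi else 0)) {0..2 * pi}"
  proof (cases "k = 0")
    case True
    then show ?thesis using has_integral_const_real[of "1::real" 0 "2 * pi"] by simp
  next
    case False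
    have "((\<lambda>x. cos (of_int k * x)) has_integral
        (sin (of_int k * (2 * pi)) / of_int k - sin (of_int k * 0) / of_int k)) {0..2 * pi}"
      using False by (intro fundamental_theorem_of_calculus)
       (auto intro!: derivative_eq_intros simp: has_real_derivative_iff_has_vector_derivative[symmetric])
    with False show ?thesis by simp
  qed
  show "((\<lambda>x. sin (of_int k * x)) has_integral 0) {0..2 * pi}"
  proof (cases "k = 0")
    case False
    have "((\<lambda>x. sin (of_int k * x)) has_integral
        (- cos (of_int k * (2 * pi)) / of_int k - (- cos (of_int k * 0) / of_int k))) {0..2 * pi}"
      using False by (intro fundamental_theorem_of_calculus)
       (auto intro!: derivative_eq_intros simp: has_real_derivative_iff_has_vector_derivative[symmetric])
    then show ?thesis by simp
  qed simp
qed

text \<open>Only frequency zero contributes. \<open>n + m\<close> vanishes only for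
  \<open>n = m = 0\<close>, where both summands count and the value doubles.\<close>

lemma has_integral_cos_cos:
  "((\<lambda>x. cos (real n * x) * cos (real m * x)) has_integral
      (if n = m then if n = 0 then 2 * pi else pi else 0)) {0..2 * pi}"
proof -
  have "((\<lambda>x. cos (real n * x) * cos (real m * x)) has_integral
     (1 / 2 * ((if int n - int m = 0 then 2 * pi else 0) + (if int n + int m = 0 then 2 * pi else 0)))) {0..2 * pi}"
    unfolding cos_mult_cos_nat by (intro has_integral_mult_right has_integral_add has_integral_cos_int)
  also have "1 / 2 * ((if int n - int m = 0 then 2 * pi else 0) + (if int n + int m = 0 then 2 * pi else 0)) =
      (if n = m then if n = 0 then 2 * pi else pi else 0)" by auto
  finally show ?thesis .
qed

lemma has_integral_sin_sin:
  "((\<lambda>x. sin (real n * x) * sin (real m * x)) has_integral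
      (if n = m \<and> n \<noteq> 0 then pi else 0)) {0..2 * pi}"
proof -
  have "((\<lambda>x. sin (real n * x) * sin (real m * x)) has_integral
     (1 / 2 * ((if int n - int m = 0 then 2 * pi else 0) - (if int n + int m = 0 then 2 * pi else 0)))) {0..2 * pi}"
    unfolding sin_mult_sin_nat by (intro has_integral_mult_right has_integral_diff has_integral_cos_int)
  also have "1 / 2 * ((if int n - int m = 0 then 2 * pi else 0) - (if int n + int m = 0 then 2 * pi else 0)) =
      (if n = m \<and> n \<noteq> 0 then pi else 0)" by auto
  finally show ?thesis .
qed

lemma has_integral_sin_cos:
  "((\<lambda>x. sin (real n * x) * cos (real m * x)) has_integral 0) {0..2 * pi}"
proof -
  have "((\<lambda>x. sin (real n * x) * cos (real m * x)) has_integral (1 / 2 * (0 + 0))) {0..2 * pi}"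
    unfolding sin_mult_cos_nat by (intro has_integral_mult_right has_integral_add has_integral_sin_int)
  then show ?thesis by simp
qed

text \<open>Multiplying by \<open>\<phi>\<close> keeps the majorant
  \<open>\<bar>a n\<bar> + \<bar>b n\<bar>\<close>, so convergence stays uniform and the sum may be
  integrated term by term.\<close>

lemma Fourier_series_integral_mult:
  assumes ab: "summable (\<lambda>n. \<bar>a n\<bar>)" "summable (\<lambda>n. \<bar>b n\<bar>)"
    and phi: "continuous_on {0..2 * pi} \<phi>" "\<And>x. \<bar>\<phi> x\<bar> \<le> 1"
    and C: "\<And>n. ((\<lambda>x. cos (real n * x) * \<phi> x) has_integral C n) {0..2 * pi}"
    and S: "\<And>n. ((\<lambda>x. sin (real n * x) * \<phi> x) has_integral S n) {0..2 * pi}"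
  shows "(\<lambda>n. a n * C n + b n * S n) sums integral {0..2 * pi} (\<lambda>x. Fourier_series a b x * \<phi> x)"
proof -
  have "uniform_limit {0..2 * pi}
     (\<lambda>N x. \<Sum>n<N. (a n * cos (real n * x) + b n * sin (real n * x)) * \<phi> x)
     (\<lambda>x. \<Sum>n. (a n * cos (real n * x) + b n * sin (real n * x)) * \<phi> x) sequentially"
  proof (rule Weierstrass_m_test)
    show "summable (\<lambda>n. \<bar>a n\<bar> + \<bar>b n\<bar>)" by (intro summable_add ab)
    show "norm ((a n * cos (real n * x) + b n * sin (real n * x)) * \<phi> x) \<le> \<bar>a n\<bar> + \<bar>b n\<bar>" for n x
      using mult_mono[OF abs_harmonic_le[of "a n" "real n * x" "b n" "real n * x"] phi(2)[of x]]
      by (simp add: abs_mult)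
  qed
  moreover have "(\<Sum>n. (a n * cos (real n * x) + b n * sin (real n * x)) * \<phi> x) =
      Fourier_series a b x * \<phi> x" for x
    unfolding Fourier_series_def by (intro suminf_mult2[symmetric] Fourier_series_summable ab)
  ultimately have ul: "uniform_limit {0..2 * pi}
     (\<lambda>N x. \<Sum>n<N. (a n * cos (real n * x) + b n * sin (real n * x)) * \<phi> x)
     (\<lambda>x. Fourier_series a b x * \<phi> x) sequentially"
    by simp
  obtain I J where IJ:
    "\<And>N. ((\<lambda>x. \<Sum>n<N. (a n * cos (real n * x) + b n * sin (real n * x)) * \<phi> x) has_integral I N) {0..2 * pi}"
    "((\<lambda>x. Fourier_series a b x * \<phi> x) has_integral J) {0..2 * pi}" "I \<longlonglongrightarrow> J"
    by (rule uniform_limit_integral[OF ul]) (auto intro!: continuous_intros phi)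
  have "((\<lambda>x. \<Sum>n<N. (a n * cos (real n * x) + b n * sin (real n * x)) * \<phi> x) has_integral
     (\<Sum>n<N. a n * C n + b n * S n)) {0..2 * pi}" for N
    using has_integral_add[OF has_integral_mult_right[OF C] has_integral_mult_right[OF S]]
    by (intro has_integral_sum) (auto simp: distrib_right mult.assoc)
  then have "I = (\<lambda>N. \<Sum>n<N. a n * C n + b n * S n)"
    using IJ(1) has_integral_unique by blast
  moreover have "J = integral {0..2 * pi} (\<lambda>x. Fourier_series a b x * \<phi> x)"
    using IJ(2) by (simp add: integral_unique)
  ultimately show ?thesis using IJ(3) by (simp add: sums_def)
qed

text \<open>Orthogonality leaves only the summand with \<open>n = m\<close>.\<close>

lemma Fourier_series_coefficients:
  assumes ab: "summable (\<lambda>n. \<bar>a n\<bar>)" "summable (\<lambda>n. \<bar>b n\<bar>)"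
  shows "integral {0..2 * pi} (\<lambda>x. Fourier_series a b x * cos (real m * x)) =
           a m * (if m = 0 then 2 * pi else pi)"
    and "integral {0..2 * pi} (\<lambda>x. Fourier_series a b x * sin (real m * x)) =
           b m * (if m = 0 then 0 else pi)"
proof -
  have "(\<lambda>n. a n * (if n = m then if n = 0 then 2 * pi else pi else 0) + b n * 0) sums
      integral {0..2 * pi} (\<lambda>x. Fourier_series a b x * cos (real m * x))"
    by (intro Fourier_series_integral_mult[OF ab] has_integral_cos_cos has_integral_sin_cos)
       (auto intro!: continuous_intros)
  moreover have "(\<lambda>n. a n * (if n = m then if n = 0 then 2 * pi else pi else 0) + b n * 0) =
     (\<lambda>n. if n = m then a n * (if m = 0 then 2 * pi else pi) else 0)" by auto
  ultimately have "(\<lambda>n. if n = m then a n * (if m = 0 then 2 * pi else pi) else 0) sums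
      integral {0..2 * pi} (\<lambda>x. Fourier_series a b x * cos (real m * x))" by (simp only:)
  then show "integral {0..2 * pi} (\<lambda>x. Fourier_series a b x * cos (real m * x)) =
           a m * (if m = 0 then 2 * pi else pi)"
    by (rule sums_unique2[OF _ sums_single])
  have "((\<lambda>x. cos (real n * x) * sin (real m * x)) has_integral 0) {0..2 * pi}" for n
    using has_integral_sin_cos[of m n] by (simp add: mult.commute)
  then have "(\<lambda>n. a n * 0 + b n * (if n = m \<and> n \<noteq> 0 then pi else 0)) sums
      integral {0..2 * pi} (\<lambda>x. Fourier_series a b x * sin (real m * x))"
    by (intro Fourier_series_integral_mult[OF ab] has_integral_sin_sin)
       (auto intro!: continuous_intros)
  moreover have "(\<lambda>n. a n * 0 + b n * (if n = m \<and> n \<noteq> 0 then pi else 0)) =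
     (\<lambda>n. if n = m then b n * (if m = 0 then 0 else pi) else 0)" by auto
  ultimately have "(\<lambda>n. if n = m then b n * (if m = 0 then 0 else pi) else 0) sums
      integral {0..2 * pi} (\<lambda>x. Fourier_series a b x * sin (real m * x))" by (simp only:)
  then show "integral {0..2 * pi} (\<lambda>x. Fourier_series a b x * sin (real m * x)) =
           b m * (if m = 0 then 0 else pi)"
    by (rule sums_unique2[OF _ sums_single])
qed

section \<open>Fourier expansion of smooth periodic functions\<close>

lemma hedgehog_deriv: "hedgehog p \<Longrightarrow> hedgehog (deriv p)"
proof -
  assume p: "hedgehog p"
  have "(deriv ^^ k) (deriv p) = (deriv ^^ Suc k) p" for k
    by (simp only: funpow_Suc_right o_apply)
  then show ?thesis
    using p hedgehog_deriv_periodic[OF p, of 1] unfolding hedgehog_def smooth_def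
    by (simp del: funpow.simps(2)) simp
qed

lemma hedgehog_has_derivative: "hedgehog p \<Longrightarrow> (p has_real_derivative deriv p x) (at x)"
  using smooth_has_derivative[of p 0] by (simp add: hedgehog_def)

lemma hedgehog_continuous: "hedgehog p \<Longrightarrow> continuous_on S p"
  by (rule DERIV_continuous_on[OF has_field_derivative_at_within[OF hedgehog_has_derivative]])

text \<open>Integration by parts; the boundary terms cancel by periodicity.\<close>

lemma Fourier_coefficients_deriv:
  assumes p: "hedgehog p"
  shows "integral {0..2 * pi} (\<lambda>x. deriv p x * cos (real n * x)) =
           real n * integral {0..2 * pi} (\<lambda>x. p x * sin (real n * x))"
    and "integral {0..2 * pi} (\<lambda>x. deriv p x * sin (real n * x)) =
           - real n * integral {0..2 * pi} (\<lambda>x. p x * cos (real n * x))"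
proof -
  note cont = hedgehog_continuous[OF p] hedgehog_continuous[OF hedgehog_deriv[OF p]]
  have p2: "p (2 * pi) = p 0" using p[unfolded hedgehog_def] by (metis add_0)
  have "((\<lambda>x. deriv p x * cos (real n * x) - real n * (p x * sin (real n * x))) has_integral
     p (2 * pi) * cos (real n * (2 * pi)) - p 0 * cos (real n * 0)) {0..2 * pi}"
    by (intro fundamental_theorem_of_calculus)
       (auto intro!: derivative_eq_intros has_field_derivative_at_within[OF hedgehog_has_derivative[OF p]]
         simp: has_real_derivative_iff_has_vector_derivative[symmetric])
  then have "integral {0..2 * pi} (\<lambda>x. deriv p x * cos (real n * x) - real n * (p x * sin (real n * x))) = 0"
    using cos_periodic_nat[of n 0] p2 by (simp add: integral_unique)
  also have "integral {0..2 * pi} (\<lambda>x. deriv p x * cos (real n * x) - real n * (p x * sin (real n * x))) =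
     integral {0..2 * pi} (\<lambda>x. deriv p x * cos (real n * x)) -
     integral {0..2 * pi} (\<lambda>x. real n * (p x * sin (real n * x)))"
    by (intro integral_diff integrable_continuous_real continuous_intros cont)
  finally show "integral {0..2 * pi} (\<lambda>x. deriv p x * cos (real n * x)) =
           real n * integral {0..2 * pi} (\<lambda>x. p x * sin (real n * x))" by simp
  have "((\<lambda>x. deriv p x * sin (real n * x) + real n * (p x * cos (real n * x))) has_integral
     p (2 * pi) * sin (real n * (2 * pi)) - p 0 * sin (real n * 0)) {0..2 * pi}"
    by (intro fundamental_theorem_of_calculus)
       (auto intro!: derivative_eq_intros has_field_derivative_at_within[OF hedgehog_has_derivative[OF p]]
         simp: has_real_derivative_iff_has_vector_derivative[symmetric])
  then have "integral {0..2 * pi} (\<lambda>x. deriv p x * sin (real n * x) + real n * (p x * cos (real n * x))) = 0"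
    using sin_periodic_nat[of n 0] p2 by (simp add: integral_unique)
  also have "integral {0..2 * pi} (\<lambda>x. deriv p x * sin (real n * x) + real n * (p x * cos (real n * x))) =
     integral {0..2 * pi} (\<lambda>x. deriv p x * sin (real n * x)) +
     integral {0..2 * pi} (\<lambda>x. real n * (p x * cos (real n * x)))"
    by (intro integral_add integrable_continuous_real continuous_intros cont)
  finally show "integral {0..2 * pi} (\<lambda>x. deriv p x * sin (real n * x)) =
           - real n * integral {0..2 * pi} (\<lambda>x. p x * cos (real n * x))" by simp
qed

text \<open>Each factor \<open>n\<close> is traded for one derivative of \<open>p\<close>, so the
  induction has to generalise over \<open>p\<close>. The base case bounds a continuous function on a
  compact interval.\<close>

lemma Fourier_coefficients_bound:
  assumes "hedgehog p"
  shows "\<exists>C. \<forall>n. \<bar>real n ^ j * integral {0..2 * pi} (\<lambda>x. p x * cos (real n * x))\<bar> \<le> C \<and>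
                 \<bar>real n ^ j * integral {0..2 * pi} (\<lambda>x. p x * sin (real n * x))\<bar> \<le> C"
  using assms
proof (induction j arbitrary: p)
  case 0
  have "compact (p ` {0..2 * pi})"
    by (intro compact_continuous_image hedgehog_continuous[OF "0.prems"]) simp
  then have "bounded (p ` {0..2 * pi})" by (rule compact_imp_bounded)
  then obtain B where "\<forall>y\<in>p ` {0..2 * pi}. norm y \<le> B"
    unfolding bounded_iff by blast
  then have B: "\<bar>p x\<bar> \<le> B" if "x \<in> {0..2 * pi}" for x
    using that by simp
  have *: "\<bar>integral {0..2 * pi} (\<lambda>x. p x * \<phi> x)\<bar> \<le> B * (2 * pi)"
    if "continuous_on {0..2 * pi} \<phi>" "\<And>x. \<bar>\<phi> x\<bar> \<le> 1" for \<phi>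
  proof -
    have "norm (p x * \<phi> x) \<le> B" if "x \<in> {0..2 * pi}" for x
      using mult_mono[OF B[OF that] \<open>\<And>x. \<bar>\<phi> x\<bar> \<le> 1\<close>[of x]] B[OF that] by (simp add: abs_mult)
    then show ?thesis
      using integral_bound[of 0 "2 * pi" "\<lambda>x. p x * \<phi> x" B] that hedgehog_continuous[OF "0.prems"]
      by (auto intro!: continuous_intros)
  qed
  show ?case
    by (intro exI[of _ "B * (2 * pi)"]) (auto intro!: * continuous_intros)
next
  case (Suc j)
  then obtain C where C: "\<And>n. \<bar>real n ^ j * integral {0..2 * pi} (\<lambda>x. deriv p x * cos (real n * x))\<bar> \<le> C"
     "\<And>n. \<bar>real n ^ j * integral {0..2 * pi} (\<lambda>x. deriv p x * sin (real n * x))\<bar> \<le> C"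
    using hedgehog_deriv by blast
  then show ?case
    unfolding Fourier_coefficients_deriv[OF Suc.prems]
    by (intro exI[of _ C]) (simp add: abs_mult mult_ac)
qed

text \<open>Two spare powers of \<open>n\<close> allow comparison with the convergent series of
  \<open>1 / n^2\<close>.\<close>

lemma rapidly_decreasingI:
  assumes "\<And>j. \<exists>C. \<forall>n. \<bar>real n ^ j * c n\<bar> \<le> C"
  shows "rapidly_decreasing c"
  unfolding rapidly_decreasing_def
proof
  fix j
  obtain C where C: "\<And>n. \<bar>real n ^ (j + 2) * c n\<bar> \<le> C" using assms by blast
  show "summable (\<lambda>n. real n ^ j * \<bar>c n\<bar>)"
  proof (rule summable_comparison_test'[where N = 1])
    show "summable (\<lambda>n. C * inverse (real n ^ 2))"
      by (intro summable_mult inverse_power_summable) simp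
    show "norm (real n ^ j * \<bar>c n\<bar>) \<le> C * inverse (real n ^ 2)" if "n \<ge> 1" for n
      using C[of n] that by (simp add: abs_mult power_add field_simps power2_eq_square)
  qed
qed

text \<open>The series built from the coefficients of \<open>p\<close> converges uniformly and has
  these same coefficients, so its difference from \<open>p\<close> vanishes by uniqueness.\<close>

lemma hedgehog_Fourier_expansion:
  assumes p: "hedgehog p"
  obtains a b where "rapidly_decreasing a" "rapidly_decreasing b" "p = Fourier_series a b"
proof -
  define a where "a n = (if n = 0 then 1 / (2 * pi) else 1 / pi) *
    integral {0..2 * pi} (\<lambda>x. p x * cos (real n * x))" for n
  define b where "b n = (1 / pi) * integral {0..2 * pi} (\<lambda>x. p x * sin (real n * x))" for n
  have A: "rapidly_decreasing (\<lambda>n. integral {0..2 * pi} (\<lambda>x. p x * cos (real n * x)))"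
    and B: "rapidly_decreasing (\<lambda>n. integral {0..2 * pi} (\<lambda>x. p x * sin (real n * x)))"
    using Fourier_coefficients_bound[OF p] by (intro rapidly_decreasingI; metis)+
  \<comment> \<open>This bounds the normalising factors \<open>1 / (2 * pi)\<close> and
    \<open>1 / pi\<close> by 1.\<close>
  have "1 \<le> pi" using pi_gt3 by linarith
  then have a: "rapidly_decreasing a"
    unfolding a_def by (intro rapidly_decreasing_bounded_mult[OF A]) auto
  have b: "rapidly_decreasing b"
    unfolding b_def by (rule rapidly_decreasing_cmult[OF B])
  note ab = a[THEN rapidly_decreasing_summable] b[THEN rapidly_decreasing_summable]
  note cont = hedgehog_continuous[OF p] Fourier_series_continuous[OF ab]
  have "p x - Fourier_series a b x = 0" for x
  proof (rule eq_0_if_Fourier_coefficients_0[where d = "\<lambda>x. p x - Fourier_series a b x"])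
    show "continuous_on UNIV (\<lambda>x. p x - Fourier_series a b x)"
      by (intro continuous_intros cont)
    show "p (x + 2 * pi) - Fourier_series a b (x + 2 * pi) = p x - Fourier_series a b x" for x
      using p by (simp add: hedgehog_def Fourier_series_periodic)
    fix n
    have "integral {0..2 * pi} (\<lambda>x. (p x - Fourier_series a b x) * cos (real n * x)) =
      integral {0..2 * pi} (\<lambda>x. p x * cos (real n * x)) -
      integral {0..2 * pi} (\<lambda>x. Fourier_series a b x * cos (real n * x))"
      unfolding left_diff_distrib
      by (intro integral_diff integrable_continuous_real continuous_intros cont)
    also have "\<dots> = 0" by (simp add: Fourier_series_coefficients[OF ab] a_def)
    finally show "integral {0..2 * pi} (\<lambda>x. (p x - Fourier_series a b x) * cos (real n * x)) = 0" .
    have "integral {0..2 * pi} (\<lambda>x. (p x - Fourier_series a b x) * sin (real n * x)) =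
      integral {0..2 * pi} (\<lambda>x. p x * sin (real n * x)) -
      integral {0..2 * pi} (\<lambda>x. Fourier_series a b x * sin (real n * x))"
      unfolding left_diff_distrib
      by (intro integral_diff integrable_continuous_real continuous_intros cont)
    also have "\<dots> = 0" by (simp add: Fourier_series_coefficients[OF ab] b_def)
    finally show "integral {0..2 * pi} (\<lambda>x. (p x - Fourier_series a b x) * sin (real n * x)) = 0" .
  qed
  then have "p = Fourier_series a b" by (simp add: fun_eq_iff)
  with a b that show ?thesis by blast
qed

section \<open>Zeros of high derivatives\<close>

text \<open>On Fourier coefficients \<open>- (n^2 + s)\<close> is the action of
  \<open>D^2 - s\<close>. The value \<open>s = l^2\<close> is used for counting zeros,
  \<open>s = 0\<close> for second derivatives and \<open>s = -1\<close> for the curvature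
  radius.\<close>

lemma rapidly_decreasing_symbol:
  assumes "rapidly_decreasing c"
  shows "rapidly_decreasing (\<lambda>n. - (real n ^ 2 + s) * c n)"
proof -
  have "rapidly_decreasing (\<lambda>n. - 1 * (real n * (real n * c n)) + - s * c n)"
    by (intro rapidly_decreasing_add rapidly_decreasing_cmult rapidly_decreasing_mult_nat assms)
  then show ?thesis by (simp add: algebra_simps power2_eq_square)
qed

lemma rapidly_decreasing_symbol_power:
  assumes "rapidly_decreasing c"
  shows "rapidly_decreasing (\<lambda>n. (- (real n ^ 2 + s)) ^ k * c n)"
proof (induction k)
  case (Suc k)
  then show ?case using rapidly_decreasing_symbol[OF Suc, of s] by (simp add: mult.assoc)
qed (simp add: assms)

text \<open>The second derivative is written as \<open>(D^2 - s) g + s * g\<close>, so that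
  \<open>D^2 - l^2\<close> can be split into two first-order factors below.\<close>

lemma Fourier_series_second_derivative:
  assumes a: "rapidly_decreasing a" and b: "rapidly_decreasing b"
  shows "((Fourier_series (\<lambda>n. real n * b n) (\<lambda>n. - (real n * a n))) has_real_derivative
      Fourier_series (\<lambda>n. - (real n ^ 2 + s) * a n) (\<lambda>n. - (real n ^ 2 + s) * b n) x
      + s * Fourier_series a b x) (at x)"
proof -
  have neg: "rapidly_decreasing (\<lambda>n. - (real n * a n))"
    using rapidly_decreasing_cmult[OF rapidly_decreasing_mult_nat[OF a], of "- 1"] by simp
  have "Fourier_series (\<lambda>n. - (real n ^ 2 + s) * a n) (\<lambda>n. - (real n ^ 2 + s) * b n) x
      + s * Fourier_series a b x =
    Fourier_series (\<lambda>n. - (real n ^ 2 + s) * a n + s * a n) (\<lambda>n. - (real n ^ 2 + s) * b n + s * b n) x"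
    by (simp only: Fourier_series_add Fourier_series_cmult[symmetric] a b
        rapidly_decreasing_symbol rapidly_decreasing_cmult)
  also have "\<dots> = Fourier_series (\<lambda>n. real n * (- (real n * a n))) (\<lambda>n. - (real n * (real n * b n))) x"
    by (rule arg_cong2[where f = "\<lambda>u v. Fourier_series u v x"])
       (simp_all add: fun_eq_iff algebra_simps power2_eq_square)
  finally show ?thesis
    using Fourier_series_has_derivative[OF rapidly_decreasing_mult_nat[OF b] neg, of x] by simp
qed

text \<open>Even orders act diagonally, while an odd order would exchange the cosine and sine
  coefficients.\<close>

lemma deriv_even_Fourier_series:
  assumes a: "rapidly_decreasing a" and b: "rapidly_decreasing b"
  shows "(deriv ^^ (2 * k)) (Fourier_series a b) =
    Fourier_series (\<lambda>n. (- (real n ^ 2)) ^ k * a n) (\<lambda>n. (- (real n ^ 2)) ^ k * b n)"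
proof (induction k)
  case (Suc k)
  let ?a = "\<lambda>n. (- (real n ^ 2)) ^ k * a n" and ?b = "\<lambda>n. (- (real n ^ 2)) ^ k * b n"
  have r: "rapidly_decreasing ?a" "rapidly_decreasing ?b"
    using rapidly_decreasing_symbol_power[of _ 0] a b by simp_all
  have "deriv (Fourier_series ?a ?b) = Fourier_series (\<lambda>n. real n * ?b n) (\<lambda>n. - (real n * ?a n))"
    using Fourier_series_has_derivative[OF r] by (intro ext DERIV_imp_deriv)
  then have "deriv (deriv (Fourier_series ?a ?b)) =
     Fourier_series (\<lambda>n. - (real n ^ 2) * ?a n) (\<lambda>n. - (real n ^ 2) * ?b n)"
    using Fourier_series_second_derivative[OF r, of 0] by (intro ext DERIV_imp_deriv) simp
  then show ?case by (simp add: Suc mult.assoc)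
qed simp

text \<open>The operator \<open>D\<^sup>2 - l\<^sup>2 = (D + l) (D - l)\<close> has the symbol \<open>- (n\<^sup>2 + l\<^sup>2)\<close>.\<close>

lemma cyclic_zeros_symbol:
  assumes a: "rapidly_decreasing a" and b: "rapidly_decreasing b"
    and Z: "cyclic_zeros N (Fourier_series a b)"
  shows "cyclic_zeros N
    (Fourier_series (\<lambda>n. - (real n ^ 2 + l ^ 2) * a n) (\<lambda>n. - (real n ^ 2 + l ^ 2) * b n))"
proof -
  let ?g = "Fourier_series a b"
  let ?g' = "Fourier_series (\<lambda>n. real n * b n) (\<lambda>n. - (real n * a n))"
  let ?r = "Fourier_series (\<lambda>n. - (real n ^ 2 + l ^ 2) * a n) (\<lambda>n. - (real n ^ 2 + l ^ 2) * b n)"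
  have "cyclic_zeros N (\<lambda>x. ?g' x - l * ?g x)"
    by (rule cyclic_zeros_deriv[OF Z Fourier_series_periodic Fourier_series_has_derivative[OF a b]])
  \<comment> \<open>The second Rolle step uses the parameter \<open>- l\<close>. With
    \<open>g'' = ?r + l^2 * g\<close> the function shown is \<open>(D + l) (D - l) g\<close>, and
    everything but \<open>?r\<close> cancels.\<close>
  then have "cyclic_zeros N (\<lambda>x. ?r x + l ^ 2 * ?g x - l * ?g' x - (- l) * (?g' x - l * ?g x))"
    by (rule cyclic_zeros_deriv)
       (simp only: Fourier_series_periodic,
        intro DERIV_diff DERIV_cmult Fourier_series_has_derivative Fourier_series_second_derivative a b)
  then show ?thesis by (simp add: algebra_simps power2_eq_square)
qed

lemma cyclic_zeros_symbol_power:
  assumes a: "rapidly_decreasing a" and b: "rapidly_decreasing b"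
    and Z: "cyclic_zeros N (Fourier_series a b)"
  shows "cyclic_zeros N
    (Fourier_series (\<lambda>n. (- (real n ^ 2 + l ^ 2)) ^ k * a n) (\<lambda>n. (- (real n ^ 2 + l ^ 2)) ^ k * b n))"
proof (induction k)
  case (Suc k)
  have "cyclic_zeros N (Fourier_series
    (\<lambda>n. - (real n ^ 2 + l ^ 2) * ((- (real n ^ 2 + l ^ 2)) ^ k * a n))
    (\<lambda>n. - (real n ^ 2 + l ^ 2) * ((- (real n ^ 2 + l ^ 2)) ^ k * b n)))"
    by (intro cyclic_zeros_symbol rapidly_decreasing_symbol_power a b Suc)
  then show ?case by (simp add: mult.assoc)
qed (simp add: Z)

lemma cyclic_zeros_even_derivatives:
  assumes a: "rapidly_decreasing a" and b: "rapidly_decreasing b"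
    and m: "m > 0" and nz: "a m \<noteq> 0 \<or> b m \<noteq> 0"
  shows "eventually (\<lambda>k. cyclic_zeros (2 * m)
    (Fourier_series (\<lambda>n. (- (real n ^ 2)) ^ k * a n) (\<lambda>n. (- (real n ^ 2)) ^ k * b n))) sequentially"
proof -
  \<comment> \<open>Chosen so that \<open>(n^2 + m^2)^2 * \<mu> n = 4 * m^2 * n^2\<close>: the
    symbol of \<open>(D^2 - m^2)^2\<close> is turned into that of \<open>D^2\<close> up to a
    constant.\<close>
  define \<mu> where "\<mu> n = 4 * real m ^ 2 * real n ^ 2 / (real n ^ 2 + real m ^ 2) ^ 2" for n
  have pos: "real n ^ 2 + real m ^ 2 > 0" for n
    using m by (simp add: add_nonneg_pos)
  \<comment> \<open>The identity behind the inequality of arithmetic and geometric means; it gives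
    \<open>\<mu> n \<le> 1\<close>, strictly unless \<open>n = m\<close>.\<close>
  have sq: "(real n ^ 2 + real m ^ 2) ^ 2 - 4 * real m ^ 2 * real n ^ 2 = (real n ^ 2 - real m ^ 2) ^ 2" for n
    by (simp add: power2_eq_square algebra_simps)
  have \<mu>0: "\<mu> n \<ge> 0" for n by (simp add: \<mu>_def)
  have pos2: "(real n ^ 2 + real m ^ 2) ^ 2 > 0" for n
    using pos[of n] by (rule zero_less_power)
  have \<mu>1: "\<mu> n \<le> 1" for n
    using sq[of n] zero_le_power2[of "real n ^ 2 - real m ^ 2"]
    unfolding \<mu>_def divide_le_eq_1_pos[OF pos2] by linarith
  have \<mu>lt: "\<mu> n < 1" if "n \<noteq> m" for n
  proof -
    have "real n ^ 2 - real m ^ 2 \<noteq> 0" using that by simp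
    then have "(real n ^ 2 - real m ^ 2) ^ 2 > 0" by simp
    then show ?thesis
      using sq[of n] unfolding \<mu>_def divide_less_eq_1_pos[OF pos2] by linarith
  qed
  have \<mu>m: "\<mu> m = 1"
    using m by (simp add: \<mu>_def power2_eq_square)
  define w where "w n = \<bar>a n\<bar> + \<bar>b n\<bar>" for n
  \<comment> \<open>A bound for the \<open>n\<close>-th term of the distance from the damped series
    to its \<open>m\<close>-th harmonic.\<close>
  define e where "e n k = (if n = m then 0 else \<mu> n ^ k * w n)" for n k
  have w: "summable w"
    unfolding w_def by (intro summable_add rapidly_decreasing_summable a b)
  have \<mu>k: "\<mu> n ^ k \<le> 1" for n k using \<mu>0 \<mu>1 by (simp add: power_le_one)
  have e_le: "norm (e n k) \<le> w n" for n k
    using \<mu>0 \<mu>k by (simp add: e_def w_def mult_left_le_one_le)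
  have e_lim: "e n \<longlonglongrightarrow> 0" for n
  proof (cases "n = m")
    case False
    then have "(\<lambda>k. \<mu> n ^ k * w n) \<longlonglongrightarrow> 0 * w n"
      by (intro tendsto_mult tendsto_const LIMSEQ_realpow_zero \<mu>0 \<mu>lt)
    with False show ?thesis by (simp add: e_def[abs_def])
  qed (simp add: e_def[abs_def])
  \<comment> \<open>Dominated convergence for series, with the majorant \<open>w\<close> independent
    of \<open>k\<close>.\<close>
  have "(\<lambda>k. \<Sum>n. e n k) \<longlonglongrightarrow> (\<Sum>n. 0)"
    using tannerys_theorem[of e "\<lambda>_. 0" sequentially w] e_lim e_le w
    by (auto intro: always_eventually)
  then have "(\<lambda>k. \<Sum>n. e n k) \<longlonglongrightarrow> 0" by simp
  moreover have "sqrt ((a m)\<^sup>2 + (b m)\<^sup>2) > 0"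
    using nz by (simp add: sum_power2_gt_zero_iff)
  ultimately have "eventually (\<lambda>k. (\<Sum>n. e n k) < sqrt ((a m)\<^sup>2 + (b m)\<^sup>2)) sequentially"
    by (rule order_tendstoD(2))
  then show ?thesis
  proof eventually_elim
    case (elim k)
    let ?a = "\<lambda>n. \<mu> n ^ k * a n" and ?b = "\<lambda>n. \<mu> n ^ k * b n"
    have r: "rapidly_decreasing ?a" "rapidly_decreasing ?b"
      using \<mu>0 \<mu>k by (auto intro!: rapidly_decreasing_bounded_mult a b simp: abs_of_nonneg)
    note rs = r[THEN rapidly_decreasing_summable]
    have near: "\<bar>Fourier_series ?a ?b x - (a m * cos (real m * x) + b m * sin (real m * x))\<bar>
        < sqrt ((a m)\<^sup>2 + (b m)\<^sup>2)" for x
    proof -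
      let ?t = "\<lambda>n. ?a n * cos (real n * x) + ?b n * sin (real n * x)"
      have "?t sums Fourier_series ?a ?b x"
        unfolding Fourier_series_def by (rule summable_sums[OF Fourier_series_summable[OF rs]])
      from sums_diff[OF this sums_single[of m ?t]]
      have d: "(\<lambda>n. if n = m then 0 else ?t n) sums (Fourier_series ?a ?b x - ?t m)"
        by (rule back_subst[of "\<lambda>f. f sums _"]) auto
      have "\<bar>if n = m then 0 else ?t n\<bar> \<le> e n k" for n
      proof -
        have "?t n = \<mu> n ^ k * (a n * cos (real n * x) + b n * sin (real n * x))"
          by (simp add: algebra_simps)
        then show ?thesis
          using \<mu>0 by (simp add: e_def w_def abs_mult mult_left_mono abs_harmonic_le)
      qed
      then have "\<bar>\<Sum>n. if n = m then 0 else ?t n\<bar> \<le> (\<Sum>n. e n k)"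
        using norm_suminf_le[of "\<lambda>n. if n = m then 0 else ?t n" "\<lambda>n. e n k"]
          summable_comparison_test'[OF w e_le] by simp
      then show ?thesis
        using elim sums_unique[OF d] \<mu>m by simp
    qed
    have "cyclic_zeros (2 * m) (Fourier_series ?a ?b)"
      by (rule cyclic_zeros_near_harmonic[OF m nz Fourier_series_continuous[OF rs] near])
    then have Z: "cyclic_zeros (2 * m) (Fourier_series
       (\<lambda>n. (- (real n ^ 2 + real m ^ 2)) ^ (2 * k) * ?a n)
       (\<lambda>n. (- (real n ^ 2 + real m ^ 2)) ^ (2 * k) * ?b n))"
      by (rule cyclic_zeros_symbol_power[OF r])
    \<comment> \<open>The exponent \<open>2 * k\<close> provides one squared symbol for each factor
      \<open>\<mu> n\<close>; the remaining constant does not depend on \<open>n\<close>.\<close>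
    have "(- (real n ^ 2 + real m ^ 2)) ^ (2 * k) * \<mu> n ^ k =
        (- 4 * real m ^ 2) ^ k * (- (real n ^ 2)) ^ k" for n
    proof -
      have "(- (real n ^ 2 + real m ^ 2)) ^ 2 * \<mu> n = (- 4 * real m ^ 2) * (- (real n ^ 2))"
        unfolding \<mu>_def power2_minus using pos2[of n] by simp
      then show ?thesis by (simp only: power_mult power_mult_distrib[symmetric])
    qed
    then have eq: "(- (real n ^ 2 + real m ^ 2)) ^ (2 * k) * (\<mu> n ^ k * y) =
        (- 4 * real m ^ 2) ^ k * ((- (real n ^ 2)) ^ k * y)" for n y
      by (simp only: mult.assoc[symmetric])
    have "rapidly_decreasing (\<lambda>n. (- (real n ^ 2)) ^ k * a n)"
         "rapidly_decreasing (\<lambda>n. (- (real n ^ 2)) ^ k * b n)"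
      using rapidly_decreasing_symbol_power[of _ 0] a b by simp_all
    \<comment> \<open>The constant \<open>(- 4 * m^2) ^ k\<close> comes out of the series and is
      nonzero, so the zeros are those of the even derivative.\<close>
    then show ?case
      using Z m unfolding eq by (simp add: cyclic_zeros_def Fourier_series_cmult)
  qed
qed

section \<open>Number of cusps of the iterated evolutes\<close>

lemma trig_polynomial_Fourier_series:
  assumes "\<And>n. n > M \<Longrightarrow> a n = 0 \<and> b n = 0"
  shows "trig_polynomial (Fourier_series a b)"
proof -
  have "Fourier_series a b x = trig_sum a b M x" for x
    unfolding Fourier_series_def trig_sum_def using assms
    by (intro suminf_finite) auto
  then show ?thesis unfolding trig_polynomial_def by blast
qed

text \<open>The sets \<open>{enat N..}\<close> form a neighbourhood base at infinity.\<close>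

lemma tendsto_enat_infinityI:
  fixes f :: "'a \<Rightarrow> enat"
  assumes "\<And>N. eventually (\<lambda>x. enat N \<le> f x) F"
  shows "(f \<longlongrightarrow> \<infinity>) F"
  using assms by (auto simp: nhds_enat filterlim_INF filterlim_principal)

lemma num_cusps_iterated_evolute_tendsto:
  assumes p: "hedgehog p" and np: "\<not> trig_polynomial p"
  shows "(\<lambda>k. num_cusps (iterated_evolute k p)) \<longlonglongrightarrow> \<infinity>"
proof (rule tendsto_enat_infinityI)
  fix N
  obtain a b where a: "rapidly_decreasing a" and b: "rapidly_decreasing b" and ab: "p = Fourier_series a b"
    using hedgehog_Fourier_expansion[OF p] .
  \<comment> \<open>Such \<open>m\<close> exists since otherwise the series would be finite. The
    bound \<open>N + 1\<close> ensures both \<open>2 * m \<ge> N\<close> and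
    \<open>m \<noteq> 1\<close>; the first harmonic, a translation of the curve, is annihilated by
    \<open>D^2 + 1\<close>.\<close>
  obtain m where m: "m > N + 1" "a m \<noteq> 0 \<or> b m \<noteq> 0"
    using trig_polynomial_Fourier_series[of "N + 1" a b] np ab by blast
  \<comment> \<open>The \<open>k\<close>-th derivative of the curvature radius
    \<open>p + p''\<close>, before the shift by quarter turns.\<close>
  define R where "R k x = (deriv ^^ k) p x + (deriv ^^ (k + 2)) p x" for k x
  have R_per: "R k (x + 2 * pi) = R k x" for k x
    by (simp only: R_def hedgehog_deriv_periodic[OF p])
  have R_deriv: "(R k has_real_derivative R (Suc k) x) (at x)" for k x
    using DERIV_add[OF smooth_has_derivative[of p k x] smooth_has_derivative[of p "k + 2" x]] p
    by (simp add: R_def[abs_def] hedgehog_def)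
  define a' b' where "a' n = - (real n ^ 2 + -1) * a n" and "b' n = - (real n ^ 2 + -1) * b n" for n
  have r: "rapidly_decreasing a'" "rapidly_decreasing b'"
    unfolding a'_def b'_def by (intro rapidly_decreasing_symbol a b)+
  have R_even: "R (2 * k) = Fourier_series (\<lambda>n. (- (real n ^ 2)) ^ k * a' n) (\<lambda>n. (- (real n ^ 2)) ^ k * b' n)" for k
  proof
    fix x
    have rk: "rapidly_decreasing (\<lambda>n. (- (real n ^ 2)) ^ k * c n)" if "rapidly_decreasing c" for c k
      using rapidly_decreasing_symbol_power[of _ 0] that by simp
    have "R (2 * k) x = (deriv ^^ (2 * k)) p x + (deriv ^^ (2 * Suc k)) p x"
      by (simp add: R_def)
    also have "\<dots> = Fourier_series
        (\<lambda>n. (- (real n ^ 2)) ^ k * a n + (- (real n ^ 2)) ^ Suc k * a n)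
        (\<lambda>n. (- (real n ^ 2)) ^ k * b n + (- (real n ^ 2)) ^ Suc k * b n) x"
      unfolding ab deriv_even_Fourier_series[OF a b]
      by (intro Fourier_series_add[symmetric] rk a b)
    also have "\<dots> = Fourier_series (\<lambda>n. (- (real n ^ 2)) ^ k * a' n) (\<lambda>n. (- (real n ^ 2)) ^ k * b' n) x"
      by (rule arg_cong2[where f = "\<lambda>u v. Fourier_series u v x"])
         (simp_all add: fun_eq_iff a'_def b'_def algebra_simps)
    finally show "R (2 * k) x = Fourier_series (\<lambda>n. (- (real n ^ 2)) ^ k * a' n)
      (\<lambda>n. (- (real n ^ 2)) ^ k * b' n) x" .
  qed
  have "real m ^ 2 \<noteq> 1 ^ 2"
    using m(1) by (subst power_eq_iff_eq_base) auto
  then have "a' m \<noteq> 0 \<or> b' m \<noteq> 0"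
    using m(2) by (simp add: a'_def b'_def)
  then have "eventually (\<lambda>k. cyclic_zeros (2 * m) (R (2 * k))) sequentially"
    unfolding R_even using m(1) by (intro cyclic_zeros_even_derivatives r) auto
  then obtain k0 where k0: "cyclic_zeros (2 * m) (R (2 * k0))"
    using eventually_happens'[OF sequentially_bot] by blast
  \<comment> \<open>One even order suffices: Rolle's theorem with \<open>l = 0\<close> passes the
    zeros on to all later derivatives, odd orders included.\<close>
  have Z: "cyclic_zeros (2 * m) (R k)" if "k \<ge> 2 * k0" for k
    using that
  proof (induction k rule: dec_induct)
    case (step k)
    have "cyclic_zeros (2 * m) (\<lambda>x. R (Suc k) x - 0 * R k x)"
      by (rule cyclic_zeros_deriv[OF step.IH R_per R_deriv])
    then show ?case by simp
  qed (rule k0)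
  have curv: "curvature_radius (iterated_evolute k p) = (\<lambda>x. R k (x - real k * pi / 2))" for k
    by (simp only: fun_eq_iff curvature_radius_iterated_evolute R_def) simp
  show "eventually (\<lambda>k. enat N \<le> num_cusps (iterated_evolute k p)) sequentially"
    using eventually_ge_at_top[of "2 * k0"]
  proof eventually_elim
    case (elim k)
    have "enat (2 * m) \<le> num_cusps (iterated_evolute k p)"
    proof (rule cyclic_zeros_le_num_cusps)
      show "cyclic_zeros (2 * m) (curvature_radius (iterated_evolute k p))"
        unfolding curv by (rule cyclic_zeros_shift[OF Z[OF elim]])
      show "curvature_radius (iterated_evolute k p) (x + 2 * pi) =
          curvature_radius (iterated_evolute k p) x" for x
        using R_per[of k "x - real k * pi / 2"] by (simp add: curv diff_add_eq)
    qed
    moreover have "enat N \<le> enat (2 * m)" using m(1) by simp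
    ultimately show ?case by (rule order_trans[rotated])
  qed
qed

theorem theorem1:
  fixes p :: "real \<Rightarrow> real"
  assumes "hedgehog p"
  shows "(\<forall>n\<ge>1. trig_polynomial_of_degree n p \<longrightarrow>
            (\<exists>(c :: nat \<Rightarrow> real) (s :: nat \<Rightarrow> real) f.
               (\<forall>k. c k \<noteq> 0) \<and> hypocycloid n f \<and> f \<noteq> (\<lambda>_. 0) \<and>
               uniform_limit UNIV (\<lambda>k \<alpha>. c k * iterated_evolute k p (\<alpha> + s k)) f sequentially))
       \<and> (\<not> trig_polynomial p \<longrightarrow>
            (\<lambda>k. num_cusps (iterated_evolute k p)) \<longlonglongrightarrow> \<infinity>)"
  using evolutes_of_trig_polynomial num_cusps_iterated_evolute_tendsto[OF assms] by blast

end
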